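(* Let $(X,\|\cdot\|)$ be an infinite-dimensional real Banach space. (1) If $X$ is separable, then there exists an equivalent norm on $X$ which is rotund and Gâteaux smooth, but is not midpoint locally uniformly rotund. Moreover, such a norm can be chosen arbitrarily close to $\|\cdot\|$. (2) If the dual space $X^*$ is separable, then there exists an equivalent norm on $X$ which is weakly uniformly rotund and Fréchet smooth, but is not midpoint locally uniformly rotund. Moreover, such a norm can be chosen arbitrarily close to $\|\cdot\|$.
   Context: Let $|\cdot|$ be an equivalent norm on $X$, with closed unit ball $B=\{x:|x|\le 1\}$ and unit sphere $S=\{x: |x|=1\}$. - $|\cdot|$ is rotund if every $x\in S$ is an extreme point of $B$, i.e. $y,z\in B$ and $2x=y+z$ imply $x=y=z$. - A point $x\in S$ is a midpoint locally uniformly rotund (MLUR) point if whenever $(x_n),(y_n)\subset X$ satisfy $|x_n|\to |x|$, $|y_n|\to|x|$ and $\left|\frac{x_n+y_n}{2}-x\right|\to 0$, then $|x_n-y_n|\to 0$. The norm $|\cdot|$ is midpoint locally uniformly rotund if every point of $S$ is an MLUR point. - $|\cdot|$ is weakly uniformly rotund if $x_n-y_n\to 0$ in the weak topology of $X$ whenever $x_n,y_n\in S$ and $|x_n+y_n|\to 2$. - $|\cdot|$ is Gâteaux smooth (respectively, Fréchet smooth) if for every $x\in S$ the limit $\lim_{h\to 0}\frac{|x+hy|+|x-hy|-2}{h}=0$ holds for every $y\in S$ (respectively, uniformly for $y\in S$). "Such a norm can be chosen arbitrarily close to $\|\cdot\|$" means: for every $\eta>0$ a norm $|\cdot|$ with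 the stated properties can be found that also satisfies $(1+\eta)^{-1}\|x\|\le |x|\le (1+\eta)\|x\|$ for all $x\in X$. *)

theory Defs
  imports "HOL-Analysis.Analysis"
begin

definition is_norm :: "('a::real_vector \<Rightarrow> real) \<Rightarrow> bool" where
  "is_norm N \<longleftrightarrow>
     (\<forall>x. N x = 0 \<longleftrightarrow> x = 0) \<and>
     (\<forall>a x. N (a *\<^sub>R x) = \<bar>a\<bar> * N x) \<and>
     (\<forall>x y. N (x + y) \<le> N x + N y)"

lemma is_norm_nonneg:
  assumes "is_norm N"
  shows "0 \<le> N x"
proof -
  have "N (- x) = N x"
    using assms unfolding is_norm_def by (metis abs_minus abs_one mult_1 scaleR_minus1_left)
  moreover have "N (x + - x) \<le> N x + N (- x)" and "N (x + - x) = 0"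
    using assms unfolding is_norm_def by (blast, simp)
  ultimately show ?thesis by linarith
qed

definition equivalent_norm :: "('a::real_normed_vector \<Rightarrow> real) \<Rightarrow> bool" where
  "equivalent_norm N \<longleftrightarrow> is_norm N \<and>
     (\<exists>a b. a > 0 \<and> b > 0 \<and> (\<forall>x. a * norm x \<le> N x \<and> N x \<le> b * norm x))"

definition unit_ball :: "('a \<Rightarrow> real) \<Rightarrow> 'a set" where
  "unit_ball N = {x. N x \<le> 1}"

definition unit_sphere :: "('a \<Rightarrow> real) \<Rightarrow> 'a set" where
  "unit_sphere N = {x. N x = 1}"

definition rotund :: "('a::real_vector \<Rightarrow> real) \<Rightarrow> bool" where
  "rotund N \<longleftrightarrow>
     (\<forall>x\<in>unit_sphere N. \<forall>y\<in>unit_ball N. \<forall>z\<in>unit_ball N.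
        2 *\<^sub>R x = y + z \<longrightarrow> x = y \<and> y = z)"

definition MLUR_point :: "('a::real_vector \<Rightarrow> real) \<Rightarrow> 'a \<Rightarrow> bool" where
  "MLUR_point N x \<longleftrightarrow>
     (\<forall>u v :: nat \<Rightarrow> 'a.
        (\<lambda>n. N (u n)) \<longlonglongrightarrow> N x \<longrightarrow>
        (\<lambda>n. N (v n)) \<longlonglongrightarrow> N x \<longrightarrow>
        (\<lambda>n. N ((u n + v n) /\<^sub>R 2 - x)) \<longlonglongrightarrow> 0 \<longrightarrow>
        (\<lambda>n. N (u n - v n)) \<longlonglongrightarrow> 0)"

definition MLUR :: "('a::real_vector \<Rightarrow> real) \<Rightarrow> bool" where
  "MLUR N \<longleftrightarrow> (\<forall>x\<in>unit_sphere N. MLUR_point N x)"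

definition weak_topology :: "'a::real_normed_vector topology" where
  "weak_topology =
     topology_generated_by {blinfun_apply f -` U | (f :: 'a \<Rightarrow>\<^sub>L real) U. open U}"

(* The weak topology is taken with respect to the ambient norm of the type; an equivalent norm
   has the same continuous functionals and hence the same weak topology. *)
definition weakly_uniformly_rotund :: "('a::real_normed_vector \<Rightarrow> real) \<Rightarrow> bool" where
  "weakly_uniformly_rotund N \<longleftrightarrow>
     (\<forall>u v :: nat \<Rightarrow> 'a.
        (\<forall>n. u n \<in> unit_sphere N) \<longrightarrow> (\<forall>n. v n \<in> unit_sphere N) \<longrightarrow>
        (\<lambda>n. N (u n + v n)) \<longlonglongrightarrow> 2 \<longrightarrow>
        limitin weak_topology (\<lambda>n. u n - v n) 0 sequentially)"

definition gateaux_smooth :: "('a::real_vector \<Rightarrow> real) \<Rightarrow> bool" where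
  "gateaux_smooth N \<longleftrightarrow>
     (\<forall>x\<in>unit_sphere N. \<forall>y\<in>unit_sphere N.
        ((\<lambda>h::real. (N (x + h *\<^sub>R y) + N (x - h *\<^sub>R y) - 2) / h) \<longlongrightarrow> 0) (at 0))"

definition frechet_smooth :: "('a::real_vector \<Rightarrow> real) \<Rightarrow> bool" where
  "frechet_smooth N \<longleftrightarrow>
     (\<forall>x\<in>unit_sphere N.
        uniform_limit (unit_sphere N)
          (\<lambda>(h::real) y. (N (x + h *\<^sub>R y) + N (x - h *\<^sub>R y) - 2) / h) (\<lambda>y. 0) (at 0))"

definition norm_close :: "real \<Rightarrow> ('a::real_normed_vector \<Rightarrow> real) \<Rightarrow> bool" where
  "norm_close \<eta> N \<longleftrightarrow>
     (\<forall>x. inverse (1 + \<eta>) * norm x \<le> N x \<and> N x \<le> (1 + \<eta>) * norm x)"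

lemma limitin_weak_topology:
  fixes u :: "nat \<Rightarrow> 'a::real_normed_vector"
  shows "limitin weak_topology u l sequentially \<longleftrightarrow>
    (\<forall>f :: 'a \<Rightarrow>\<^sub>L real. (\<lambda>n. blinfun_apply f (u n)) \<longlonglongrightarrow> blinfun_apply f l)"
proof
  assume L: "limitin weak_topology u l sequentially"
  show "\<forall>f :: 'a \<Rightarrow>\<^sub>L real. (\<lambda>n. blinfun_apply f (u n)) \<longlonglongrightarrow> blinfun_apply f l"
  proof (intro allI topological_tendstoI)
    fix f :: "'a \<Rightarrow>\<^sub>L real" and S assume S: "open S" "blinfun_apply f l \<in> S"
    have "openin weak_topology (blinfun_apply f -` S)"
      unfolding weak_topology_def using S by (intro topology_generated_by_Basis) blast
    then show "\<forall>\<^sub>F n in sequentially. blinfun_apply f (u n) \<in> S"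
      using L S unfolding limitin_def by (auto dest!: spec[of _ "blinfun_apply f -` S"])
  qed
next
  assume R: "\<forall>f :: 'a \<Rightarrow>\<^sub>L real. (\<lambda>n. blinfun_apply f (u n)) \<longlonglongrightarrow> blinfun_apply f l"
  have "l \<in> blinfun_apply (0 :: 'a \<Rightarrow>\<^sub>L real) -` UNIV" by simp
  then have "l \<in> topspace weak_topology"
    unfolding weak_topology_def topology_generated_by_topspace by blast
  moreover have "\<forall>\<^sub>F n in sequentially. u n \<in> W"
    if W: "openin weak_topology W" "l \<in> W" for W
  proof -
    have "generate_topology_on {blinfun_apply f -` U | (f :: 'a \<Rightarrow>\<^sub>L real) U. open U} W"
      using W(1) unfolding weak_topology_def openin_topology_generated_by_iff .
    then show ?thesis using W(2)
    proof (induction rule: generate_topology_on.induct)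
      case (Int a b)
      then show ?case by (auto intro: eventually_conj)
    next
      case (UN K)
      then obtain k where "k \<in> K" "l \<in> k" by blast
      with UN have "\<forall>\<^sub>F n in sequentially. u n \<in> k" by blast
      then show ?case by eventually_elim (use \<open>k \<in> K\<close> in blast)
    next
      case (Basis s)
      then obtain f :: "'a \<Rightarrow>\<^sub>L real" and U where "s = blinfun_apply f -` U" "open U" by blast
      with Basis R show ?case by (auto dest: topological_tendstoD)
    qed auto
  qed
  ultimately show "limitin weak_topology u l sequentially"
    unfolding limitin_def by blast
qed

end

theory Submission
  imports Defs
begin

text \<open>
  Take functionals \<open>f i\<close> of norm at most 1 that separate points (and whose multiples are dense in the
  dual, if that is separable), vectors \<open>x i\<close> with dense span such that \<open>f 0 (x 0) \<noteq> 0\<close> and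
  \<open>f 0 (x i) = 0\<close> for \<open>i > 0\<close>, and a multiple \<open>\<phi>\<close> of \<open>f 0\<close> of norm slightly above 1. The unit
  ball of \<open>G v = max (norm v) \<bar>\<phi> v\<bar>\<close> has a flat face. The new norm is the square root of
  \<open>F + \<eta> * \<rho>\<close>, where \<open>\<rho> v\<close> is the weighted sum of the \<open>(f i v)\<^sup>2\<close> and \<open>F v\<close> is the infimum
  of \<open>(G (v - (\<Sum>i. k i)))\<^sup>2 + (\<Sum>i. a i * (norm (k i))\<^sup>2)\<close> over finitely supported \<open>k\<close>
  with \<open>k i\<close> in a subspace \<open>K i\<close>; these subspaces are the lines through the \<open>x i\<close> and the common
  kernels of \<open>f 0, \<dots>, f i\<close>.

  The parallelogram law for \<open>\<rho>\<close> gives (weak uniform) rotundity. Moving only the component of a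
  nearly optimal \<open>k\<close> along a line shows that second differences of \<open>F\<close> in the direction \<open>x i\<close> are
  quadratic, whence Gateaux smoothness. On the kernel of \<open>f 0, \<dots>, f i\<close> the second differences are
  controlled by the norm of a subgradient restricted to that kernel, which tends to 0 if the multiples
  of the \<open>f i\<close> are dense; modulo the kernel the unit ball is totally bounded, whence Frechet
  smoothness. Finally, \<open>\<phi>\<close> vanishes on all \<open>K i\<close> with \<open>i > 0\<close>, so an optimal \<open>k\<close> can be
  computed for a suitable point lying over the flat face. Perturbing this point by vectors of constant
  norm in the kernels of \<open>f 0, \<dots>, f n\<close> does not increase \<open>F\<close> and changes \<open>\<rho>\<close> by a null
  sequence, so the norm is not midpoint locally uniformly rotund there.
\<close>

section \<open>The Hahn--Banach theorem\<close>

text \<open>Homogeneity is demanded only as an inequality for positive \<open>c\<close>, which is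
  all that has to be checked for infima; applying it to \<open>c\<close> and to its inverse gives
  the equality.\<close>

definition sublinear :: "('a::real_vector \<Rightarrow> real) \<Rightarrow> bool" where
  "sublinear p \<longleftrightarrow> (\<forall>x y. p (x + y) \<le> p x + p y) \<and> (\<forall>c>0. \<forall>x. p (c *\<^sub>R x) \<le> c * p x)"

lemma sublinear_add: "sublinear p \<Longrightarrow> p (x + y) \<le> p x + p y"
  by (simp add: sublinear_def)

lemma sublinear_zero:
  assumes "sublinear p" shows "p 0 = 0"
proof -
  \<comment> \<open>The factor 2 forces \<open>p 0\<close> to be nonnegative, the factor 1/2 forces
    it to be nonpositive.\<close>
  have "p (2 *\<^sub>R 0) \<le> 2 * p 0" "p ((1/2) *\<^sub>R 0) \<le> (1/2) * p 0"
    using assms unfolding sublinear_def by (meson zero_less_numeral, meson half_gt_zero zero_less_one)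
  then show ?thesis by simp
qed

lemma sublinear_scale:
  assumes "sublinear p" "c \<ge> 0" shows "p (c *\<^sub>R x) = c * p x"
proof (cases "c = 0")
  case True
  then show ?thesis using sublinear_zero[OF assms(1)] by simp
next
  case False
  with assms(2) have c: "c > 0" by simp
  have "p (inverse c *\<^sub>R (c *\<^sub>R x)) \<le> inverse c * p (c *\<^sub>R x)"
    using assms(1) c unfolding sublinear_def by (meson positive_imp_inverse_positive)
  then have "c * p x \<le> p (c *\<^sub>R x)" using c by (simp add: field_simps)
  moreover have "p (c *\<^sub>R x) \<le> c * p x" using assms(1) c unfolding sublinear_def by blast
  ultimately show ?thesis by simp
qed

lemma sublinear_minus:
  assumes "sublinear p" shows "- p (- x) \<le> p x"
  using sublinear_add[OF assms, of x "- x"] sublinear_zero[OF assms] by simp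

text \<open>The infimum of \<open>q (x + t *\<^sub>R x0) - t * q x0\<close> over nonnegative
  \<open>t\<close> is finite, being at least \<open>- q (- x)\<close>. Taking \<open>t = 0\<close>
  puts it below \<open>q\<close>, and \<open>t = 1\<close> at \<open>- x0\<close> gives the last
  bound. A minimal sublinear functional cannot be decreased in this way, so it is odd.\<close>

lemma sublinear_decrease:
  assumes q: "sublinear q"
  shows "\<exists>r. sublinear r \<and> (\<forall>x. r x \<le> q x) \<and> r (- x0) \<le> - q x0"
proof -
  define r where "r x = (INF t\<in>{0..}. q (x + t *\<^sub>R x0) - t * q x0)" for x
  have low: "- q (- x) \<le> q (x + t *\<^sub>R x0) - t * q x0" if "t \<ge> 0" for x t
  proof -
    have "t * q x0 = q (t *\<^sub>R x0)" using sublinear_scale[OF q that] by simp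
    also have "\<dots> \<le> q (x + t *\<^sub>R x0) + q (- x)"
      using sublinear_add[OF q, of "x + t *\<^sub>R x0" "- x"] by simp
    finally show ?thesis by simp
  qed
  have bdd: "bdd_below ((\<lambda>t. q (x + t *\<^sub>R x0) - t * q x0) ` {0..})" for x
    using low by (intro bdd_belowI2) auto
  have up: "r x \<le> q (x + t *\<^sub>R x0) - t * q x0" if "t \<ge> 0" for x t
    unfolding r_def using that by (intro cINF_lower[OF bdd]) auto
  have ne: "{0::real..} \<noteq> {}" by auto
  have "r (x + y) \<le> r x + r y" for x y
  proof -
    have "r (x + y) - r y \<le> q (x + s *\<^sub>R x0) - s * q x0" if s: "s \<ge> 0" for s
    proof -
      have "r (x + y) - (q (x + s *\<^sub>R x0) - s * q x0) \<le> q (y + t *\<^sub>R x0) - t * q x0"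
        if t: "t \<ge> 0" for t
      proof -
        have "r (x + y) \<le> q ((x + y) + (s + t) *\<^sub>R x0) - (s + t) * q x0" using up s t by simp
        moreover have "q ((x + y) + (s + t) *\<^sub>R x0) \<le> q (x + s *\<^sub>R x0) + q (y + t *\<^sub>R x0)"
          using sublinear_add[OF q, of "x + s *\<^sub>R x0" "y + t *\<^sub>R x0"] by (simp add: algebra_simps)
        ultimately show ?thesis by (simp add: algebra_simps)
      qed
      then have "r (x + y) - (q (x + s *\<^sub>R x0) - s * q x0) \<le> r y"
        unfolding r_def[of y] by (intro cINF_greatest[OF ne]) auto
      then show ?thesis by simp
    qed
    then have "r (x + y) - r y \<le> r x"
      unfolding r_def[of x] by (intro cINF_greatest[OF ne]) auto
    then show ?thesis by simp
  qed
  moreover have "r (c *\<^sub>R x) \<le> c * r x" if c: "c > 0" for c x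
  proof -
    have "r (c *\<^sub>R x) / c \<le> q (x + t *\<^sub>R x0) - t * q x0" if t: "t \<ge> 0" for t
    proof -
      have "r (c *\<^sub>R x) \<le> q (c *\<^sub>R x + (c * t) *\<^sub>R x0) - (c * t) * q x0" using up c t by simp
      also have "c *\<^sub>R x + (c * t) *\<^sub>R x0 = c *\<^sub>R (x + t *\<^sub>R x0)" by (simp add: algebra_simps)
      also have "q \<dots> = c * q (x + t *\<^sub>R x0)" using sublinear_scale[OF q] c by simp
      finally show ?thesis using c by (simp add: field_simps)
    qed
    then have "r (c *\<^sub>R x) / c \<le> r x" unfolding r_def[of x] by (intro cINF_greatest[OF ne]) auto
    then show ?thesis using c by (simp add: field_simps)
  qed
  ultimately have "sublinear r" unfolding sublinear_def by blast
  moreover have "r x \<le> q x" for x using up[of 0 x] by simp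
  moreover have "r (- x0) \<le> - q x0" using up[of 1 "- x0"] sublinear_zero[OF q] by simp
  ultimately show ?thesis by blast
qed

lemma linear_if_odd:
  assumes q: "sublinear q" and odd: "\<And>x. q (- x) \<le> - q x"
  shows "linear q"
proof -
  have odd': "q (- x) = - q x" for x using odd[of x] sublinear_minus[OF q, of x] by simp
  show ?thesis
  proof (rule linearI)
    fix x y
    have "q x \<le> q (x + y) + q (- y)" using sublinear_add[OF q, of "x + y" "- y"] by simp
    then show "q (x + y) = q x + q y" using odd'[of y] sublinear_add[OF q, of x y] by simp
  next
    fix c x
    show "q (c *\<^sub>R x) = c *\<^sub>R q x"
    proof (cases "c \<ge> 0")
      case True
      then show ?thesis using sublinear_scale[OF q] by simp
    next
      case False
      then have "q ((- c) *\<^sub>R x) = - c * q x" using sublinear_scale[OF q, of "- c" x] by simp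
      then show ?thesis using odd'[of "c *\<^sub>R x"] by simp
    qed
  qed
qed

text \<open>By Zorn's lemma there is a minimal sublinear functional below \<open>p\<close>; minimality and
  \<open>sublinear_decrease\<close> make it odd.\<close>

lemma hahn_banach:
  fixes p :: "'a::real_vector \<Rightarrow> real"
  assumes p: "sublinear p"
  shows "\<exists>f. linear f \<and> (\<forall>x. f x \<le> p x) \<and> f x0 = p x0"
proof -
  \<comment> \<open>Decreasing \<open>p\<close> at \<open>- x0\<close> beforehand makes every linear
    functional below \<open>r\<close> take the value \<open>p x0\<close> at
    \<open>x0\<close>.\<close>
  obtain r where r: "sublinear r" "\<And>x. r x \<le> p x" "r (- x0) \<le> - p x0"
    using sublinear_decrease[OF p] by blast
  define A where "A = {q. sublinear q \<and> (\<forall>x. q x \<le> r x)}"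
  \<comment> \<open>The order is reversed, so that a maximal element in Zorn's lemma is a minimal
    functional.\<close>
  define P where "P = (\<lambda>q s :: 'a \<Rightarrow> real. \<forall>x. s x \<le> q x)"
  have "\<exists>m\<in>A. \<forall>a\<in>A. P m a \<longrightarrow> a = m"
  proof (rule predicate_Zorn)
    show "partial_order_on A (relation_of P A)"
      by (rule partial_order_on_relation_ofI) (auto simp: P_def fun_eq_iff intro: order_trans antisym)
  next
    fix C assume "C \<in> Chains (relation_of P A)"
    then have CA: "C \<subseteq> A" and ch: "\<And>a b. a \<in> C \<Longrightarrow> b \<in> C \<Longrightarrow> P a b \<or> P b a"
      unfolding Chains_def relation_of_def by auto
    show "\<exists>u\<in>A. \<forall>a\<in>C. P a u"
    proof (cases "C = {}")
      case True
      then show ?thesis using r(1) by (auto simp: A_def)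
    next
      case ne: False
      define u where "u x = (INF q\<in>C. q x)" for x
      have low: "- r (- x) \<le> q x" if "q \<in> C" for q x
      proof -
        have "q (- x) \<le> r (- x)" "- q (- x) \<le> q x"
          using CA that sublinear_minus unfolding A_def by blast+
        then show ?thesis by simp
      qed
      have bdd: "bdd_below ((\<lambda>q. q x) ` C)" for x using low by (intro bdd_belowI2) auto
      have up: "u x \<le> q x" if "q \<in> C" for q x
        unfolding u_def using that by (intro cINF_lower[OF bdd]) auto
      have "u (x + y) \<le> u x + u y" for x y
      proof -
        have "u (x + y) - u y \<le> q x" if q: "q \<in> C" for q
        proof -
          have "u (x + y) - q x \<le> s y" if s: "s \<in> C" for s
          proof -
            \<comment> \<open>Two members of a chain are comparable, so subadditivity of the smaller
              one serves for both.\<close>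
            consider "P q s" | "P s q" using ch q s by blast
            then obtain v where v: "v \<in> C" "\<And>z. v z \<le> q z" "\<And>z. v z \<le> s z"
              using q s unfolding P_def by (metis order_refl)
            then have "u (x + y) \<le> v x + v y"
              using CA sublinear_add[of v x y] up[of v "x + y"] unfolding A_def
              by (metis (no_types, lifting) mem_Collect_eq order_trans subset_eq)
            then show ?thesis using v(2)[of x] v(3)[of y] by simp
          qed
          then have "u (x + y) - q x \<le> u y" unfolding u_def[of y] by (intro cINF_greatest[OF ne])
          then show ?thesis by simp
        qed
        then have "u (x + y) - u y \<le> u x" unfolding u_def[of x] by (intro cINF_greatest[OF ne])
        then show ?thesis by simp
      qed
      moreover have "u (c *\<^sub>R x) \<le> c * u x" if c: "c > 0" for c x
      proof -
        have "u (c *\<^sub>R x) / c \<le> q x" if q: "q \<in> C" for q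
        proof -
          have "q (c *\<^sub>R x) \<le> c * q x" using CA q c unfolding A_def sublinear_def by blast
          then show ?thesis using up[OF q, of "c *\<^sub>R x"] c by (simp add: field_simps)
        qed
        then have "u (c *\<^sub>R x) / c \<le> u x" unfolding u_def[of x] by (intro cINF_greatest[OF ne])
        then show ?thesis using c by (simp add: field_simps)
      qed
      ultimately have "sublinear u" unfolding sublinear_def by blast
      moreover have "u x \<le> r x" for x
      proof -
        obtain q where "q \<in> C" using ne by blast
        then have "u x \<le> q x" "q x \<le> r x" using up CA unfolding A_def by auto
        then show ?thesis by simp
      qed
      ultimately have "u \<in> A" unfolding A_def by blast
      then show ?thesis using up unfolding P_def by blast
    qed
  qed
  then obtain m where m: "m \<in> A" "\<And>a. a \<in> A \<Longrightarrow> P m a \<Longrightarrow> a = m" by blast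
  have sm: "sublinear m" "\<And>x. m x \<le> r x" using m(1) unfolding A_def by auto
  have "m (- x) \<le> - m x" for x
  proof -
    obtain s where s: "sublinear s" "\<And>y. s y \<le> m y" "s (- x) \<le> - m x"
      using sublinear_decrease[OF sm(1)] by blast
    have "s \<in> A" unfolding A_def using s sm order_trans by blast
    then have "s = m" using m(2) s(2) unfolding P_def by blast
    then show ?thesis using s(3) by simp
  qed
  then have lin: "linear m" using linear_if_odd sm(1) by blast
  have mp: "m x \<le> p x" for x using sm(2) r(2) order_trans by blast
  have "m (- x0) \<le> - p x0" using sm(2)[of "- x0"] r(3) by simp
  then have "p x0 \<le> m x0" using linear_neg[OF lin, of x0] by simp
  with mp[of x0] have "m x0 = p x0" by simp
  with lin mp show ?thesis by blast
qed

lemma hahn_banach_blinfun: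
  fixes p :: "'a::real_normed_vector \<Rightarrow> real"
  assumes p: "sublinear p" and b: "\<And>x. p x \<le> b * norm x"
  shows "\<exists>f :: 'a \<Rightarrow>\<^sub>L real. (\<forall>x. f x \<le> p x) \<and> f x0 = p x0"
proof -
  obtain f where f: "linear f" "\<And>x. f x \<le> p x" "f x0 = p x0" using hahn_banach[OF p] by blast
  have "norm (f x) \<le> norm x * b" for x
  proof -
    have "f x \<le> b * norm x" "f (- x) \<le> b * norm (- x)" using f(2) b order_trans by blast+
    then show ?thesis using linear_neg[OF f(1), of x] by (simp add: abs_le_iff mult.commute)
  qed
  then have "bounded_linear f"
    using f(1) by (intro bounded_linear_intro[where K=b]) (auto simp: linear_add linear_scale)
  then show ?thesis using f bounded_linear_Blinfun_apply by metis
qed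

lemma norming_functional:
  fixes x0 :: "'a::real_normed_vector"
  shows "\<exists>f :: 'a \<Rightarrow>\<^sub>L real. norm f \<le> 1 \<and> blinfun_apply f x0 = norm x0"
proof -
  have "sublinear (norm :: 'a \<Rightarrow> real)" by (simp add: sublinear_def norm_triangle_ineq)
  then obtain f :: "'a \<Rightarrow>\<^sub>L real" where f: "\<And>x. f x \<le> norm x" "f x0 = norm x0"
    using hahn_banach_blinfun[of norm 1 x0] by auto
  have "norm (f x) \<le> 1 * norm x" for x
    using f(1)[of x] f(1)[of "- x"] by (simp add: abs_le_iff blinfun.minus_right)
  then have "norm f \<le> 1" by (intro norm_blinfun_bound) auto
  with f(2) show ?thesis by blast
qed

text \<open>The distance to \<open>M\<close> is sublinear, at most the norm, zero on
  \<open>M\<close> and positive at \<open>x0\<close>. A linear functional below it that agrees with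
  it at \<open>x0\<close> separates.\<close>

lemma separating_functional:
  fixes M :: "'a::real_normed_vector set"
  assumes M: "subspace M" and x0: "x0 \<notin> closure M"
  shows "\<exists>f :: 'a \<Rightarrow>\<^sub>L real. (\<forall>x\<in>M. blinfun_apply f x = 0) \<and> blinfun_apply f x0 \<noteq> 0"
proof -
  define p where "p x = infdist x M" for x
  have ne: "M \<noteq> {}" using M subspace_0 by blast
  have low: "p x \<le> norm (x - m)" if "m \<in> M" for x m
    unfolding p_def using infdist_le[OF that, of x] by (simp add: dist_norm)
  have near: "\<exists>m\<in>M. norm (x - m) < p x + e" if "e > 0" for x e
    using ne cInf_lessD[of "dist x ` M" "p x + e"] that unfolding p_def
    by (auto simp: dist_norm infdist_notempty)
  have "p (x + y) \<le> p x + p y" for x y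
  proof (rule field_le_epsilon)
    fix e :: real assume "e > 0"
    then obtain m n where mn: "m \<in> M" "norm (x - m) < p x + e / 2" "n \<in> M" "norm (y - n) < p y + e / 2"
      using near[of "e/2"] by (meson half_gt_zero)
    have "p (x + y) \<le> norm ((x + y) - (m + n))" using low subspace_add[OF M] mn by blast
    also have "\<dots> \<le> norm (x - m) + norm (y - n)"
      using norm_triangle_ineq[of "x - m" "y - n"] by (simp add: algebra_simps)
    finally show "p (x + y) \<le> p x + p y + e" using mn by simp
  qed
  moreover have "p (c *\<^sub>R x) \<le> c * p x" if c: "c > 0" for c x
  proof (rule field_le_epsilon)
    fix e :: real assume "e > 0"
    then obtain m where m: "m \<in> M" "norm (x - m) < p x + e / c"
      using near[of "e/c" x] c by auto
    have "p (c *\<^sub>R x) \<le> norm (c *\<^sub>R x - c *\<^sub>R m)" using low subspace_scale[OF M m(1)] by blast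
    also have "\<dots> = c * norm (x - m)" using c by (simp flip: scaleR_diff_right)
    also have "\<dots> \<le> c * (p x + e / c)" using m(2) c by (intro mult_left_mono) auto
    also have "\<dots> = c * p x + e" using c by (simp add: distrib_left)
    finally show "p (c *\<^sub>R x) \<le> c * p x + e" .
  qed
  ultimately have "sublinear p" unfolding sublinear_def by blast
  moreover have "p x \<le> 1 * norm x" for x using low[OF subspace_0[OF M], of x] by simp
  ultimately obtain f :: "'a \<Rightarrow>\<^sub>L real" where f: "\<And>x. f x \<le> p x" "f x0 = p x0"
    using hahn_banach_blinfun by blast
  have "f x = 0" if "x \<in> M" for x
  proof -
    have "p x = 0" "p (- x) = 0" using that subspace_neg[OF M] unfolding p_def by auto
    then show ?thesis using f(1)[of x] f(1)[of "- x"] by (simp add: blinfun.minus_right)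
  qed
  moreover have "f x0 \<noteq> 0" using x0 f(2) ne in_closure_iff_infdist_zero[of M x0] unfolding p_def by auto
  ultimately show ?thesis by blast
qed

section \<open>Second differences of convex functions\<close>

lemma is_norm_minus: "is_norm N \<Longrightarrow> N (- x) = N x"
  unfolding is_norm_def by (metis abs_minus abs_one mult_1 scaleR_minus1_left)

lemma convex_onD_UNIV:
  assumes "convex_on UNIV F" "u \<ge> 0" "v \<ge> 0" "u + v = 1"
  shows "F (u *\<^sub>R x + v *\<^sub>R y) \<le> u * F x + v * F y"
  using assms unfolding convex_on_def by blast

text \<open>With \<open>s\<close> and \<open>t\<close> the square roots of \<open>Q x\<close> and
  \<open>Q y\<close>, the rescaled vectors satisfy \<open>Q = 1\<close>, and
  \<open>inverse (s + t) *\<^sub>R (x + y)\<close> is their convex combination with weights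
  \<open>s / (s + t)\<close> and \<open>t / (s + t)\<close>. Convexity of \<open>Q\<close> thus
  yields the triangle inequality.\<close>

lemma is_norm_sqrt:
  fixes Q :: "'a::real_vector \<Rightarrow> real"
  assumes conv: "convex_on UNIV Q" and hom: "\<And>c x. Q (c *\<^sub>R x) = c\<^sup>2 * Q x"
    and pos: "\<And>x. x \<noteq> 0 \<Longrightarrow> 0 < Q x"
  shows "is_norm (\<lambda>x. sqrt (Q x))"
proof -
  have Q0: "Q 0 = 0" using hom[of 0 0] by simp
  have tri: "sqrt (Q (x + y)) \<le> sqrt (Q x) + sqrt (Q y)" for x y
  proof (cases "x = 0 \<or> y = 0")
    case True
    then show ?thesis using Q0 by auto
  next
    case False
    define s t where "s = sqrt (Q x)" and "t = sqrt (Q y)"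
    have st: "s > 0" "t > 0" using False pos unfolding s_def t_def by auto
    have sq: "Q x = s\<^sup>2" "Q y = t\<^sup>2" using st unfolding s_def t_def by auto
    have "Q ((s / (s + t)) *\<^sub>R (inverse s *\<^sub>R x) + (t / (s + t)) *\<^sub>R (inverse t *\<^sub>R y))
        \<le> (s / (s + t)) * Q (inverse s *\<^sub>R x) + (t / (s + t)) * Q (inverse t *\<^sub>R y)"
      by (rule convex_onD_UNIV[OF conv]) (use st in \<open>auto simp flip: add_divide_distrib\<close>)
    also have "\<dots> = s / (s + t) + t / (s + t)" using st by (simp add: hom sq field_simps)
    also have "\<dots> = 1" using st by (simp flip: add_divide_distrib)
    also have "(s / (s + t)) *\<^sub>R (inverse s *\<^sub>R x) + (t / (s + t)) *\<^sub>R (inverse t *\<^sub>R y)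
        = inverse (s + t) *\<^sub>R (x + y)"
    proof -
      have "s / (s + t) * inverse s = inverse (s + t)" "t / (s + t) * inverse t = inverse (s + t)"
        using st by (auto simp: field_simps)
      then show ?thesis by (simp add: scaleR_add_right)
    qed
    finally have "(inverse (s + t))\<^sup>2 * Q (x + y) \<le> 1" by (simp only: hom)
    then have "Q (x + y) \<le> (s + t)\<^sup>2" using st by (simp add: field_simps)
    then have "sqrt (Q (x + y)) \<le> s + t" using st real_le_lsqrt pos Q0
      by (metis add_pos_pos less_le less_eq_real_def real_sqrt_le_mono real_sqrt_unique)
    then show ?thesis unfolding s_def t_def .
  qed
  have "sqrt (Q x) = 0 \<longleftrightarrow> x = 0" for x using pos[of x] Q0 by (cases "x = 0") auto
  moreover have "sqrt (Q (c *\<^sub>R x)) = \<bar>c\<bar> * sqrt (Q x)" for c x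
    by (simp add: hom real_sqrt_mult)
  ultimately show ?thesis using tri unfolding is_norm_def by blast
qed

text \<open>For convex \<open>F\<close> this symmetric second difference is nonnegative, so upper
  bounds alone express smoothness.\<close>

definition sdiff :: "('a::real_vector \<Rightarrow> real) \<Rightarrow> 'a \<Rightarrow> 'a \<Rightarrow> real" where
  "sdiff F x h = F (x + h) + F (x - h) - 2 * F x"

lemma sdiff_minus [simp]: "sdiff F x (- h) = sdiff F x h"
  by (simp add: sdiff_def)

lemma sdiff_abs: "sdiff F x (t *\<^sub>R h) = sdiff F x (\<bar>t\<bar> *\<^sub>R h)"
  using sdiff_minus[of F x "t *\<^sub>R h"] by (cases "t \<ge> 0") auto

lemma convex_midpoint:
  assumes "convex_on UNIV F"
  shows "F ((1/2) *\<^sub>R (x + y)) \<le> (F x + F y) / 2"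
  using convex_onD[OF assms, of "1/2" x y] by (simp add: scaleR_add_right add_divide_distrib)

text \<open>The points \<open>x + (u + v)\<close> and \<open>x - (u + v)\<close> are midpoints of
  the points reached by the doubled steps. This splits a direction into parts that can be estimated
  separately.\<close>

lemma sdiff_add:
  assumes "convex_on UNIV F"
  shows "sdiff F x (u + v) \<le> (sdiff F x (2 *\<^sub>R u) + sdiff F x (2 *\<^sub>R v)) / 2"
proof -
  have *: "(1/2) *\<^sub>R ((x + 2 *\<^sub>R u) + (x + 2 *\<^sub>R v)) = x + (u + v)"
    "(1/2) *\<^sub>R ((x - 2 *\<^sub>R u) + (x - 2 *\<^sub>R v)) = x - (u + v)"
    by (simp_all add: algebra_simps flip: scaleR_2)
  show ?thesis
    using convex_midpoint[OF assms, of "x + 2 *\<^sub>R u" "x + 2 *\<^sub>R v"]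
      convex_midpoint[OF assms, of "x - 2 *\<^sub>R u" "x - 2 *\<^sub>R v"]
    unfolding * sdiff_def by simp
qed

text \<open>The triangle inequality suffices. The bound is of first order in \<open>h\<close> and
  says nothing about smoothness; it serves to absorb directions of small norm.\<close>

lemma sdiff_norm_power2_le:
  fixes P :: "'a::real_normed_vector \<Rightarrow> real"
  assumes P: "is_norm P" and L: "\<And>x. P x \<le> L * norm x" "L \<ge> 0"
  shows "sdiff (\<lambda>x. (P x)\<^sup>2) x h \<le> 4 * L\<^sup>2 * norm x * norm h + 2 * L\<^sup>2 * (norm h)\<^sup>2"
proof -
  have nn: "P y \<ge> 0" for y using is_norm_nonneg[OF P] .
  have tri: "P (y + z) \<le> P y + P z" for y z using P unfolding is_norm_def by blast
  have "P (x + h) \<le> P x + P h" "P (x - h) \<le> P x + P h"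
    using tri[of x h] tri[of x "- h"] is_norm_minus[OF P, of h] by auto
  then have "(P (x + h))\<^sup>2 \<le> (P x + P h)\<^sup>2" "(P (x - h))\<^sup>2 \<le> (P x + P h)\<^sup>2"
    using nn by (auto intro: power_mono)
  then have "sdiff (\<lambda>x. (P x)\<^sup>2) x h \<le> 4 * (P x * P h) + 2 * (P h)\<^sup>2"
    unfolding sdiff_def by (simp add: power2_sum)
  also have "\<dots> \<le> 4 * ((L * norm x) * (L * norm h)) + 2 * (L * norm h)\<^sup>2"
    using nn L by (intro add_mono mult_left_mono mult_mono power_mono) auto
  finally show ?thesis by (simp add: power2_eq_square algebra_simps)
qed

text \<open>Second differences in these directions are \<open>o(t)\<close>. Since they form a closed
  subspace, smoothness need only be checked on a set with dense span.\<close>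

definition smooth_directions :: "('a::real_vector \<Rightarrow> real) \<Rightarrow> 'a \<Rightarrow> 'a set" where
  "smooth_directions F x =
     {w. \<forall>e>0. \<exists>\<tau>>0. \<forall>t. 0 < t \<and> t < \<tau> \<longrightarrow> sdiff F x (t *\<^sub>R w) \<le> e * t}"

lemma subspace_smooth_directions:
  assumes conv: "convex_on UNIV F"
  shows "subspace (smooth_directions F x)"
proof (rule subspaceI)
  show "0 \<in> smooth_directions F x"
    unfolding smooth_directions_def sdiff_def by (auto intro: exI[of _ 1])
next
  fix u v assume uv: "u \<in> smooth_directions F x" "v \<in> smooth_directions F x"
  show "u + v \<in> smooth_directions F x"
    unfolding smooth_directions_def
  proof (intro CollectI allI impI)
    fix e :: real assume e: "e > 0"
    then have e2: "e / 2 > 0" by simp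
    obtain a where a: "a > 0" "\<And>t. 0 < t \<Longrightarrow> t < a \<Longrightarrow> sdiff F x (t *\<^sub>R u) \<le> e / 2 * t"
      using uv(1) e2 unfolding smooth_directions_def by blast
    obtain b where b: "b > 0" "\<And>t. 0 < t \<Longrightarrow> t < b \<Longrightarrow> sdiff F x (t *\<^sub>R v) \<le> e / 2 * t"
      using uv(2) e2 unfolding smooth_directions_def by blast
    \<comment> \<open>The radius is halved because \<open>sdiff_add\<close> doubles both steps;
      likewise below.\<close>
    show "\<exists>\<tau>>0. \<forall>t. 0 < t \<and> t < \<tau> \<longrightarrow> sdiff F x (t *\<^sub>R (u + v)) \<le> e * t"
    proof (intro exI[of _ "min a b / 2"] conjI allI impI)
      show "min a b / 2 > 0" using a b by simp
      fix t :: real assume t: "0 < t \<and> t < min a b / 2"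
      have "sdiff F x (t *\<^sub>R u + t *\<^sub>R v)
          \<le> (sdiff F x (2 *\<^sub>R t *\<^sub>R u) + sdiff F x (2 *\<^sub>R t *\<^sub>R v)) / 2"
        by (rule sdiff_add[OF conv])
      also have "\<dots> \<le> (e / 2 * (2 * t) + e / 2 * (2 * t)) / 2"
        using a(2)[of "2 * t"] b(2)[of "2 * t"] t by simp
      finally show "sdiff F x (t *\<^sub>R (u + v)) \<le> e * t" by (simp add: scaleR_add_right)
    qed
  qed
next
  fix c u assume u: "u \<in> smooth_directions F x"
  show "c *\<^sub>R u \<in> smooth_directions F x"
  proof (cases "c = 0")
    case True
    then show ?thesis
      unfolding smooth_directions_def sdiff_def by (auto intro: exI[of _ 1])
  next
    case c: False
    show ?thesis unfolding smooth_directions_def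
    proof (intro CollectI allI impI)
      fix e :: real assume e: "e > 0"
      then have ec: "e / \<bar>c\<bar> > 0" using c by simp
      obtain a where a: "a > 0" "\<And>t. 0 < t \<Longrightarrow> t < a \<Longrightarrow> sdiff F x (t *\<^sub>R u) \<le> e / \<bar>c\<bar> * t"
        using u ec unfolding smooth_directions_def by blast
      show "\<exists>\<tau>>0. \<forall>t. 0 < t \<and> t < \<tau> \<longrightarrow> sdiff F x (t *\<^sub>R (c *\<^sub>R u)) \<le> e * t"
      proof (intro exI[of _ "a / \<bar>c\<bar>"] conjI allI impI)
        show "a / \<bar>c\<bar> > 0" using a c by simp
        fix t :: real assume t: "0 < t \<and> t < a / \<bar>c\<bar>"
        then have "0 < t * \<bar>c\<bar>" "t * \<bar>c\<bar> < a" using c by (auto simp: field_simps)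
        then have "sdiff F x ((t * \<bar>c\<bar>) *\<^sub>R u) \<le> e * t"
          using a(2)[of "t * \<bar>c\<bar>"] c by simp
        then show "sdiff F x (t *\<^sub>R (c *\<^sub>R u)) \<le> e * t"
          using sdiff_abs[of F x "t * c" u] t by (simp add: abs_mult)
      qed
    qed
  qed
qed

text \<open>A limit direction \<open>w\<close> splits into a smooth direction \<open>v\<close> and
  the rest \<open>w - v\<close>. For the rest, the first-order term of \<open>bound\<close> is small
  because \<open>w - v\<close> is, and the second-order term because \<open>t\<close> is.\<close>

lemma closed_smooth_directions:
  fixes F :: "'a::real_normed_vector \<Rightarrow> real"
  assumes conv: "convex_on UNIV F" and AB: "A \<ge> 0" "B \<ge> 0"
    and bound: "\<And>h. sdiff F x h \<le> A * norm h + B * (norm h)\<^sup>2"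
  shows "closed (smooth_directions F x)"
proof -
  have "w \<in> smooth_directions F x" if w: "w \<in> closure (smooth_directions F x)" for w
    unfolding smooth_directions_def
  proof (intro CollectI allI impI)
    fix e :: real assume e: "e > 0"
    define d where "d = min 1 (e / (4 * (A + 1)))"
    have d: "d > 0" "d \<le> 1" "A * d \<le> e / 4"
    proof -
      show "d > 0" "d \<le> 1" using e AB unfolding d_def by auto
      have "A * d \<le> A * (e / (4 * (A + 1)))" using AB unfolding d_def by (intro mult_left_mono) auto
      also have "\<dots> \<le> e / 4" using e AB by (simp add: field_simps)
      finally show "A * d \<le> e / 4" .
    qed
    obtain v where v: "v \<in> smooth_directions F x" "norm (w - v) < d"
      using w d(1) unfolding closure_approachable by (metis dist_norm norm_minus_commute)
    obtain a where a: "a > 0" "\<And>t. 0 < t \<Longrightarrow> t < a \<Longrightarrow> sdiff F x (t *\<^sub>R v) \<le> e / 2 * t"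
      using v(1) half_gt_zero[OF e] unfolding smooth_directions_def by blast
    define b where "b = min (a / 2) (e / (8 * (B + 1)))"
    have b: "b > 0" "b \<le> a / 2" using a(1) e AB unfolding b_def by (simp_all only: min.cobounded1) auto
    have "sdiff F x (t *\<^sub>R w) \<le> e * t" if t: "0 < t" "t < b" for t
    proof -
      have "t * (8 * (B + 1)) \<le> e" using t AB unfolding b_def by (simp add: field_simps)
      then have Bt: "2 * B * t \<le> e / 4" using t by (simp add: algebra_simps)
      have nw: "norm (w - v) \<ge> 0" "norm (w - v) \<le> d" using v by auto
      have "(norm (w - v))\<^sup>2 \<le> 1" using nw d by (simp add: power_le_one)
      then have B2: "2 * B * t * (norm (w - v))\<^sup>2 \<le> e / 4"
        using mult_left_mono[of "(norm (w - v))\<^sup>2" 1 "2 * B * t"] AB t Bt by simp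
      have A2: "A * norm (w - v) \<le> e / 4" using d(3) nw(2) AB(1) mult_left_mono order_trans by blast
      have "sdiff F x (2 *\<^sub>R (t *\<^sub>R (w - v))) \<le>
          A * norm (2 *\<^sub>R (t *\<^sub>R (w - v))) + B * (norm (2 *\<^sub>R (t *\<^sub>R (w - v))))\<^sup>2"
        by (rule bound)
      also have "norm (2 *\<^sub>R (t *\<^sub>R (w - v))) = 2 * t * norm (w - v)" using t by simp
      also have "A * (2 * t * norm (w - v)) + B * (2 * t * norm (w - v))\<^sup>2
          = 2 * t * (A * norm (w - v)) + 2 * t * (2 * B * t * (norm (w - v))\<^sup>2)"
        by (simp add: power2_eq_square)
      also have "\<dots> \<le> 2 * t * (e / 4) + 2 * t * (e / 4)"
        using t A2 B2 by (intro add_mono mult_left_mono) auto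
      finally have 1: "sdiff F x (2 *\<^sub>R (t *\<^sub>R (w - v))) \<le> e * t" by simp
      have 2: "sdiff F x (2 *\<^sub>R (t *\<^sub>R v)) \<le> e * t" using a(2)[of "2 * t"] t b by simp
      have "t *\<^sub>R w = t *\<^sub>R v + t *\<^sub>R (w - v)" by (simp add: algebra_simps)
      then show ?thesis using sdiff_add[OF conv, of x "t *\<^sub>R v" "t *\<^sub>R (w - v)"] 1 2 by simp
    qed
    then show "\<exists>\<tau>>0. \<forall>t. 0 < t \<and> t < \<tau> \<longrightarrow> sdiff F x (t *\<^sub>R w) \<le> e * t" using b(1) by blast
  qed
  then show ?thesis by (metis closure_subset closure_eq subsetI subset_antisym)
qed

section \<open>Infimal convolution with a weighted sequence of subspaces\<close>

lemma is_norm_norm: "is_norm (norm :: 'a::real_normed_vector \<Rightarrow> real)"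
  by (simp add: is_norm_def norm_triangle_ineq)

lemma is_norm_power2_convex:
  assumes N: "is_norm N" and uv: "u \<ge> 0" "v \<ge> 0" "u + v = 1"
  shows "(N (u *\<^sub>R x + v *\<^sub>R y))\<^sup>2 \<le> u * (N x)\<^sup>2 + v * (N y)\<^sup>2"
proof -
  have "N (u *\<^sub>R x + v *\<^sub>R y) \<le> N (u *\<^sub>R x) + N (v *\<^sub>R y)"
    using N unfolding is_norm_def by blast
  also have "\<dots> = u * N x + v * N y" using N uv unfolding is_norm_def by simp
  finally have "(N (u *\<^sub>R x + v *\<^sub>R y))\<^sup>2 \<le> (u * N x + v * N y)\<^sup>2"
    using is_norm_nonneg[OF N] by (intro power_mono)
  \<comment> \<open>The convexity defect of the square is exactly \<open>u * v\<close> times the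
    squared difference.\<close>
  also have "\<dots> = u * (N x)\<^sup>2 + v * (N y)\<^sup>2 - u * v * (N x - N y)\<^sup>2"
  proof -
    have v: "v = 1 - u" using uv by simp
    show ?thesis unfolding v by (simp add: power2_eq_square algebra_simps)
  qed
  also have "\<dots> \<le> u * (N x)\<^sup>2 + v * (N y)\<^sup>2" using uv by simp
  finally show ?thesis .
qed

text \<open>The bound on the sums of \<open>1 / a i\<close> is what lets the cost control the norm
  of the total, and so keeps the infimal convolution equivalent to the squared norm.\<close>

locale inf_convolution =
  fixes G :: "'a::real_normed_vector \<Rightarrow> real" and K :: "nat \<Rightarrow> 'a set"
    and a :: "nat \<Rightarrow> real" and \<delta> L :: real
  assumes G_norm: "is_norm G" and G_lower: "norm x \<le> G x" and G_upper: "G x \<le> L * norm x"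
    and K_subspace: "subspace (K i)" and a_pos: "a i > 0"
    and a_sum: "finite A \<Longrightarrow> (\<Sum>i\<in>A. 1 / a i) \<le> \<delta>" and \<delta>_pos: "\<delta> > 0"
begin

text \<open>Finite support makes \<open>tot\<close> and \<open>cost\<close> finite sums. The proofs
  do not presuppose minimizers and use the nearly optimal \<open>k\<close> of
  \<open>F_near\<close>.\<close>

definition adm :: "(nat \<Rightarrow> 'a) set" where
  "adm = {k. (\<forall>i. k i \<in> K i) \<and> finite {i. k i \<noteq> 0}}"

definition tot :: "(nat \<Rightarrow> 'a) \<Rightarrow> 'a" where
  "tot k = (\<Sum>i | k i \<noteq> 0. k i)"

definition cost :: "(nat \<Rightarrow> 'a) \<Rightarrow> real" where
  "cost k = (\<Sum>i | k i \<noteq> 0. a i * (norm (k i))\<^sup>2)"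

definition F :: "'a \<Rightarrow> real" where
  "F x = (INF k\<in>adm. (G (x - tot k))\<^sup>2 + cost k)"

lemma tot_eq: "finite A \<Longrightarrow> {i. k i \<noteq> 0} \<subseteq> A \<Longrightarrow> tot k = (\<Sum>i\<in>A. k i)"
  unfolding tot_def by (rule sum.mono_neutral_left) auto

lemma cost_eq: "finite A \<Longrightarrow> {i. k i \<noteq> 0} \<subseteq> A \<Longrightarrow> cost k = (\<Sum>i\<in>A. a i * (norm (k i))\<^sup>2)"
  unfolding cost_def by (rule sum.mono_neutral_left) auto

lemma cost_nonneg: "cost k \<ge> 0"
  unfolding cost_def using a_pos by (intro sum_nonneg) (simp add: less_imp_le)

lemma adm_zero: "(\<lambda>i. 0) \<in> adm"
  unfolding adm_def using subspace_0[OF K_subspace] by simp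

lemma tot_zero [simp]: "tot (\<lambda>i. 0) = 0" and cost_zero [simp]: "cost (\<lambda>i. 0) = 0"
  by (simp_all add: tot_def cost_def)

lemma adm_combination:
  assumes k: "k \<in> adm" and l: "l \<in> adm"
  shows "(\<lambda>i. u *\<^sub>R k i + v *\<^sub>R l i) \<in> adm"
    and "tot (\<lambda>i. u *\<^sub>R k i + v *\<^sub>R l i) = u *\<^sub>R tot k + v *\<^sub>R tot l"
    and "u \<ge> 0 \<Longrightarrow> v \<ge> 0 \<Longrightarrow> u + v = 1 \<Longrightarrow>
      cost (\<lambda>i. u *\<^sub>R k i + v *\<^sub>R l i) \<le> u * cost k + v * cost l"
proof -
  define A where "A = {i. k i \<noteq> 0} \<union> {i. l i \<noteq> 0}"
  have A: "finite A" "{i. k i \<noteq> 0} \<subseteq> A" "{i. l i \<noteq> 0} \<subseteq> A"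
    "{i. u *\<^sub>R k i + v *\<^sub>R l i \<noteq> 0} \<subseteq> A"
    using k l unfolding A_def adm_def by auto
  show "(\<lambda>i. u *\<^sub>R k i + v *\<^sub>R l i) \<in> adm"
    unfolding adm_def
  proof (intro CollectI conjI allI)
    show "u *\<^sub>R k i + v *\<^sub>R l i \<in> K i" for i
      using k l subspace_add[OF K_subspace] subspace_scale[OF K_subspace] unfolding adm_def by auto
    show "finite {i. u *\<^sub>R k i + v *\<^sub>R l i \<noteq> 0}" using A finite_subset by blast
  qed
  show "tot (\<lambda>i. u *\<^sub>R k i + v *\<^sub>R l i) = u *\<^sub>R tot k + v *\<^sub>R tot l"
    unfolding tot_eq[OF A(1,2)] tot_eq[OF A(1,3)] tot_eq[OF A(1,4)]
    by (simp add: sum.distrib scaleR_right.sum)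
  assume uv: "u \<ge> 0" "v \<ge> 0" "u + v = 1"
  have "a i * (norm (u *\<^sub>R k i + v *\<^sub>R l i))\<^sup>2
      \<le> u * (a i * (norm (k i))\<^sup>2) + v * (a i * (norm (l i))\<^sup>2)" for i
    using mult_left_mono[OF is_norm_power2_convex[OF is_norm_norm uv] less_imp_le[OF a_pos]]
    by (simp add: algebra_simps)
  then show "cost (\<lambda>i. u *\<^sub>R k i + v *\<^sub>R l i) \<le> u * cost k + v * cost l"
    unfolding cost_eq[OF A(1,2)] cost_eq[OF A(1,3)] cost_eq[OF A(1,4)]
    by (simp add: sum_distrib_left sum_mono flip: sum.distrib)
qed

lemma adm_scale:
  assumes k: "k \<in> adm"
  shows "(\<lambda>i. c *\<^sub>R k i) \<in> adm" "tot (\<lambda>i. c *\<^sub>R k i) = c *\<^sub>R tot k"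
    "cost (\<lambda>i. c *\<^sub>R k i) = c\<^sup>2 * cost k"
proof -
  show "(\<lambda>i. c *\<^sub>R k i) \<in> adm" "tot (\<lambda>i. c *\<^sub>R k i) = c *\<^sub>R tot k"
    using adm_combination(1,2)[OF k k, of c 0] by simp_all
  show "cost (\<lambda>i. c *\<^sub>R k i) = c\<^sup>2 * cost k"
  proof (cases "c = 0")
    case False
    then show ?thesis by (simp add: cost_def sum_distrib_left power_mult_distrib mult_ac)
  qed simp
qed

text \<open>Shifting a single component is the variation behind all smoothness estimates: it moves
  the total by \<open>h\<close> and alters one term of the cost.\<close>

lemma adm_update:
  assumes k: "k \<in> adm" and h: "h \<in> K n"
  shows "k(n := k n + h) \<in> adm" "tot (k(n := k n + h)) = tot k + h"
    "cost (k(n := k n + h)) = cost k + a n * ((norm (k n + h))\<^sup>2 - (norm (k n))\<^sup>2)"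
proof -
  define A where "A = insert n {i. k i \<noteq> 0}"
  have A: "finite A" "{i. k i \<noteq> 0} \<subseteq> A" "{i. (k(n := k n + h)) i \<noteq> 0} \<subseteq> A" "n \<in> A"
    using k unfolding A_def adm_def by auto
  show "k(n := k n + h) \<in> adm"
    using k h finite_subset[OF A(3,1)] subspace_add[OF K_subspace] unfolding adm_def by auto
  show "tot (k(n := k n + h)) = tot k + h"
    unfolding tot_eq[OF A(1,2)] tot_eq[OF A(1,3)] sum.remove[OF A(1,4)]
    by simp
  show "cost (k(n := k n + h)) = cost k + a n * ((norm (k n + h))\<^sup>2 - (norm (k n))\<^sup>2)"
    unfolding cost_eq[OF A(1,2)] cost_eq[OF A(1,3)] sum.remove[OF A(1,4)]
    by (simp add: algebra_simps)
qed

text \<open>This is the Cauchy-Schwarz inequality after writing \<open>norm (k i)\<close> as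
  \<open>1 / sqrt (a i)\<close> times \<open>sqrt (a i) * norm (k i)\<close>.\<close>

lemma norm_tot_le: 
  assumes k: "k \<in> adm"
  shows "(norm (tot k))\<^sup>2 \<le> \<delta> * cost k"
proof -
  let ?A = "{i. k i \<noteq> 0}"
  have A: "finite ?A" using k unfolding adm_def by auto
  have "norm (tot k) \<le> (\<Sum>i\<in>?A. norm (k i))" unfolding tot_def by (rule norm_sum)
  also have "\<dots> = (\<Sum>i\<in>?A. (1 / sqrt (a i)) * (sqrt (a i) * norm (k i)))"
    using a_pos by (intro sum.cong) (auto simp: less_imp_neq[symmetric])
  finally have "(norm (tot k))\<^sup>2 \<le> (\<Sum>i\<in>?A. (1 / sqrt (a i)) * (sqrt (a i) * norm (k i)))\<^sup>2"
    by (intro power_mono) auto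
  also have "\<dots> \<le> (\<Sum>i\<in>?A. (1 / sqrt (a i))\<^sup>2) * (\<Sum>i\<in>?A. (sqrt (a i) * norm (k i))\<^sup>2)"
    by (rule Cauchy_Schwarz_ineq_sum)
  also have "\<dots> = (\<Sum>i\<in>?A. 1 / a i) * cost k"
    unfolding cost_def using a_pos by (simp add: power_divide power_mult_distrib less_imp_le)
  also have "\<dots> \<le> \<delta> * cost k" using a_sum[OF A] cost_nonneg by (intro mult_right_mono)
  finally show ?thesis .
qed

lemma F_le: "k \<in> adm \<Longrightarrow> F x \<le> (G (x - tot k))\<^sup>2 + cost k"
  unfolding F_def using cost_nonneg by (intro cINF_lower bdd_belowI2[of _ 0]) auto

lemma F_greatest: "(\<And>k. k \<in> adm \<Longrightarrow> m \<le> (G (x - tot k))\<^sup>2 + cost k) \<Longrightarrow> m \<le> F x"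
  unfolding F_def using adm_zero by (intro cINF_greatest) auto

lemma F_near: 
  assumes "e > 0"
  obtains k where "k \<in> adm" "(G (x - tot k))\<^sup>2 + cost k < F x + e"
  using assms F_greatest[of "F x + e" x] by (meson less_add_same_cancel1 not_le)

lemma F_nonneg: "F x \<ge> 0"
  using cost_nonneg by (intro F_greatest) simp

lemma F_le_G: "F x \<le> (G x)\<^sup>2"
  using F_le[OF adm_zero, of x] by simp

lemma norm_le_F: "(norm x)\<^sup>2 \<le> (1 + \<delta>) * F x"
proof -
  have "(norm x)\<^sup>2 / (1 + \<delta>) \<le> F x"
  proof (rule F_greatest)
    fix k assume k: "k \<in> adm"
    define p q where "p = norm (x - tot k)" and "q = norm (tot k)"
    have q: "q\<^sup>2 / \<delta> \<le> cost k"
      using norm_tot_le[OF k] \<delta>_pos unfolding q_def by (simp add: field_simps)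
    have "norm x \<le> p + q" unfolding p_def q_def using norm_triangle_ineq[of "x - tot k" "tot k"] by simp
    then have "(norm x)\<^sup>2 \<le> (p + q)\<^sup>2" by (intro power_mono) auto
    \<comment> \<open>Weighted inequality between \<open>p\<close> and \<open>q\<close>, with its
      defect written as a square; the weight \<open>1 / \<delta>\<close> matches
      \<open>norm_tot_le\<close>.\<close>
    also have "\<dots> = (1 + \<delta>) * (p\<^sup>2 + q\<^sup>2 / \<delta>) - (\<delta> * p - q)\<^sup>2 / \<delta>"
      using \<delta>_pos by (simp add: field_simps power2_eq_square)
    also have "\<dots> \<le> (1 + \<delta>) * (p\<^sup>2 + q\<^sup>2 / \<delta>)" using \<delta>_pos by simp
    also have "\<dots> \<le> (1 + \<delta>) * ((G (x - tot k))\<^sup>2 + cost k)"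
      using \<delta>_pos q G_lower unfolding p_def by (intro mult_left_mono add_mono power_mono) auto
    finally show "(norm x)\<^sup>2 / (1 + \<delta>) \<le> (G (x - tot k))\<^sup>2 + cost k"
      using \<delta>_pos by (simp add: field_simps)
  qed
  then show ?thesis using \<delta>_pos by (simp add: field_simps)
qed

lemma F_pos: "x \<noteq> 0 \<Longrightarrow> F x > 0"
  using norm_le_F[of x] \<delta>_pos F_nonneg[of x] by (cases "F x = 0") auto

lemma F_scale: "F (c *\<^sub>R x) = c\<^sup>2 * F x"
proof -
  have le: "F (c *\<^sub>R x) \<le> c\<^sup>2 * F x" if c: "c \<noteq> 0" for c x
  proof -
    have "F (c *\<^sub>R x) / c\<^sup>2 \<le> F x"
    proof (rule F_greatest)
      fix k assume k: "k \<in> adm"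
      have "F (c *\<^sub>R x) \<le> (G (c *\<^sub>R x - c *\<^sub>R tot k))\<^sup>2 + c\<^sup>2 * cost k"
        using F_le[OF adm_scale(1)[OF k], of "c *\<^sub>R x" c] adm_scale(2,3)[OF k] by simp
      also have "G (c *\<^sub>R x - c *\<^sub>R tot k) = \<bar>c\<bar> * G (x - tot k)"
        using G_norm unfolding is_norm_def by (simp flip: scaleR_diff_right)
      finally show "F (c *\<^sub>R x) / c\<^sup>2 \<le> (G (x - tot k))\<^sup>2 + cost k"
        using c by (simp add: power_mult_distrib field_simps)
    qed
    then show ?thesis using c by (simp add: field_simps)
  qed
  show ?thesis
  proof (cases "c = 0")
    case True
    have "G 0 = 0" using G_norm unfolding is_norm_def by blast
    then show ?thesis using True F_le_G[of 0] F_nonneg[of 0] by simp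
  next
    case False
    then have "F x \<le> (inverse c)\<^sup>2 * F (c *\<^sub>R x)" using le[of "inverse c" "c *\<^sub>R x"] by simp
    then have "c\<^sup>2 * F x \<le> F (c *\<^sub>R x)" using False by (simp add: field_simps)
    then show ?thesis using le[OF False, of x] by simp
  qed
qed

lemma F_convex: "convex_on UNIV F"
  unfolding convex_on_def
proof (intro conjI ballI allI impI)
  fix x y :: 'a and u v :: real assume uv: "0 \<le> u" "0 \<le> v" "u + v = 1"
  show "F (u *\<^sub>R x + v *\<^sub>R y) \<le> u * F x + v * F y"
  proof (rule field_le_epsilon)
    fix e :: real assume e: "e > 0"
    obtain k where k: "k \<in> adm" "(G (x - tot k))\<^sup>2 + cost k < F x + e" by (rule F_near[OF e])
    obtain l where l: "l \<in> adm" "(G (y - tot l))\<^sup>2 + cost l < F y + e" by (rule F_near[OF e])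
    have "F (u *\<^sub>R x + v *\<^sub>R y)
        \<le> (G (u *\<^sub>R x + v *\<^sub>R y - (u *\<^sub>R tot k + v *\<^sub>R tot l)))\<^sup>2 + (u * cost k + v * cost l)"
      using F_le[OF adm_combination(1)[OF k(1) l(1)], of "u *\<^sub>R x + v *\<^sub>R y" u v]
        adm_combination(2,3)[OF k(1) l(1), of u v] uv by simp
    also have "u *\<^sub>R x + v *\<^sub>R y - (u *\<^sub>R tot k + v *\<^sub>R tot l) = u *\<^sub>R (x - tot k) + v *\<^sub>R (y - tot l)"
      by (simp add: algebra_simps)
    also have "(G (u *\<^sub>R (x - tot k) + v *\<^sub>R (y - tot l)))\<^sup>2 + (u * cost k + v * cost l)
        \<le> u * ((G (x - tot k))\<^sup>2 + cost k) + v * ((G (y - tot l))\<^sup>2 + cost l)"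
      using is_norm_power2_convex[OF G_norm uv, of "x - tot k" "y - tot l"] by (simp add: algebra_simps)
    also have "\<dots> \<le> u * (F x + e) + v * (F y + e)"
      using k(2) l(2) uv by (intro add_mono[OF mult_left_mono mult_left_mono]) auto
    also have "\<dots> = u * F x + v * F y + (u + v) * e" by (simp add: algebra_simps)
    finally show "F (u *\<^sub>R x + v *\<^sub>R y) \<le> u * F x + v * F y + e" using uv by simp
  qed
qed simp

lemma is_norm_sqrt_F: "is_norm (\<lambda>x. sqrt (F x))"
  using F_convex F_scale F_pos by (rule is_norm_sqrt)

text \<open>Shifting component \<open>n\<close> by \<open>h\<close> or \<open>- h\<close> decomposes
  \<open>x + h\<close> or \<open>x - h\<close> with the same remainder \<open>x - tot k\<close>. The
  possibly nonsmooth \<open>G\<close> drops out, leaving a second difference of the squared norm on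
  \<open>K n\<close>.\<close>

lemma sdiff_F_perturb:
  assumes k: "k \<in> adm" "(G (x - tot k))\<^sup>2 + cost k < F x + e" and h: "h \<in> K n"
  shows "sdiff F x h \<le> 2 * e + a n * ((norm (k n + h))\<^sup>2 + (norm (k n - h))\<^sup>2 - 2 * (norm (k n))\<^sup>2)"
proof -
  have h': "- h \<in> K n" using h K_subspace subspace_neg by blast
  have "F (x + h) \<le> (G (x - tot k))\<^sup>2 + cost k + a n * ((norm (k n + h))\<^sup>2 - (norm (k n))\<^sup>2)"
    using F_le[OF adm_update(1)[OF k(1) h], of "x + h"] adm_update(2,3)[OF k(1) h] by simp
  moreover have "F (x - h) \<le> (G (x - tot k))\<^sup>2 + cost k + a n * ((norm (k n - h))\<^sup>2 - (norm (k n))\<^sup>2)"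
    using F_le[OF adm_update(1)[OF k(1) h'], of "x - h"] adm_update(2,3)[OF k(1) h'] by simp
  ultimately show ?thesis using k(2) unfolding sdiff_def by (simp add: algebra_simps)
qed

text \<open>On a line the squared norm is quadratic, so its second difference is
  \<open>2 * (norm h)\<^sup>2\<close> whatever the component \<open>k n\<close> is.\<close>

lemma sdiff_F_line:
  assumes K: "K n = range (\<lambda>c. c *\<^sub>R w)" and h: "h \<in> K n"
  shows "sdiff F x h \<le> 2 * a n * (norm h)\<^sup>2"
proof (rule field_le_epsilon)
  fix e :: real assume "e > 0"
  then obtain k where k: "k \<in> adm" "(G (x - tot k))\<^sup>2 + cost k < F x + e / 2"
    using F_near[of "e/2" x] by auto
  have "k n \<in> K n" using k unfolding adm_def by blast
  then obtain b c where "k n = b *\<^sub>R w" "h = c *\<^sub>R w" using h unfolding K by blast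
  then have "(norm (k n + h))\<^sup>2 + (norm (k n - h))\<^sup>2 - 2 * (norm (k n))\<^sup>2 = 2 * (norm h)\<^sup>2"
    by (simp add: power_mult_distrib power2_sum power2_diff algebra_simps
        flip: scaleR_add_left scaleR_diff_left)
  then show "sdiff F x h \<le> 2 * a n * (norm h)\<^sup>2 + e"
    using sdiff_F_perturb[OF k h] by (simp add: algebra_simps)
qed

text \<open>Comparing \<open>x\<close> with \<open>x - k n\<close> bounds the component \<open>k n\<close> of a nearly optimal
  decomposition by the norm of the subgradient on \<open>K n\<close>.\<close>

lemma sdiff_F_subgradient:
  assumes f: "linear f" "\<And>h. F x + f h \<le> F (x + h)"
    and d: "d \<ge> 0" "\<And>y. y \<in> K n \<Longrightarrow> f y \<le> d * norm y" and h: "h \<in> K n"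
  shows "sdiff F x h \<le> 4 * d * norm h + 2 * a n * (norm h)\<^sup>2"
proof -
  have bound: "sdiff F x h \<le> 2 * e + 4 * (d + sqrt (a n * e)) * norm h + 2 * a n * (norm h)\<^sup>2"
    if e: "e > 0" for e
  proof -
    obtain k where k: "k \<in> adm" "(G (x - tot k))\<^sup>2 + cost k < F x + e" by (rule F_near[OF e])
    have kn: "k n \<in> K n" "- k n \<in> K n" using k K_subspace subspace_neg unfolding adm_def by blast+
    have "F (x - k n) \<le> (G (x - tot k))\<^sup>2 + cost k - a n * (norm (k n))\<^sup>2"
      using F_le[OF adm_update(1)[OF k(1) kn(2)], of "x - k n"] adm_update(2,3)[OF k(1) kn(2)] by simp
    moreover have "F x - f (k n) \<le> F (x - k n)"
      using f(2)[of "- k n"] linear_neg[OF f(1)] by simp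
    ultimately have "a n * (norm (k n))\<^sup>2 \<le> e + d * norm (k n)"
      using k(2) d(2)[OF kn(1)] by linarith
    then have "a n * (a n * (norm (k n))\<^sup>2) \<le> a n * (e + d * norm (k n))"
      using a_pos by (intro mult_left_mono) (auto simp: less_imp_le)
    then have b: "(a n * norm (k n))\<^sup>2 \<le> a n * e + d * (a n * norm (k n))"
      by (simp add: power2_eq_square algebra_simps)
    have "a n * norm (k n) \<le> d + sqrt (a n * e)"
    proof (rule ccontr)
      assume "\<not> ?thesis"
      moreover define s where "s = sqrt (a n * e)"
      moreover define \<beta> where "\<beta> = a n * norm (k n)"
      ultimately have gt: "\<beta> - d > s" by simp
      have s: "s > 0" "s\<^sup>2 = a n * e" using a_pos[of n] e unfolding s_def by auto
      have "s * s < \<beta> * (\<beta> - d)" using gt s d by (intro mult_strict_mono) auto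
      then show False using b s unfolding \<beta>_def[symmetric] by (simp add: power2_eq_square algebra_simps)
    qed
    then have *: "a n * norm (k n) * norm h \<le> (d + sqrt (a n * e)) * norm h"
      by (intro mult_right_mono) auto
    have "(norm (k n + h))\<^sup>2 \<le> (norm (k n) + norm h)\<^sup>2" "(norm (k n - h))\<^sup>2 \<le> (norm (k n) + norm h)\<^sup>2"
      by (intro power_mono norm_triangle_ineq norm_triangle_ineq4; simp)+
    then have "(norm (k n + h))\<^sup>2 + (norm (k n - h))\<^sup>2 - 2 * (norm (k n))\<^sup>2
        \<le> 4 * (norm (k n) * norm h) + 2 * (norm h)\<^sup>2"
      by (simp add: power2_sum)
    then have "a n * ((norm (k n + h))\<^sup>2 + (norm (k n - h))\<^sup>2 - 2 * (norm (k n))\<^sup>2)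
        \<le> a n * (4 * (norm (k n) * norm h) + 2 * (norm h)\<^sup>2)"
      using a_pos by (intro mult_left_mono) (auto simp: less_imp_le)
    then show ?thesis using sdiff_F_perturb[OF k h] * by (simp add: algebra_simps)
  qed
  have "((\<lambda>e. 2 * e + 4 * (d + sqrt (a n * e)) * norm h + 2 * a n * (norm h)\<^sup>2) \<longlongrightarrow>
      2 * 0 + 4 * (d + sqrt (a n * 0)) * norm h + 2 * a n * (norm h)\<^sup>2) (at_right 0)"
    by (intro tendsto_intros)
  then have "sdiff F x h \<le> 2 * 0 + 4 * (d + sqrt (a n * 0)) * norm h + 2 * a n * (norm h)\<^sup>2"
    by (rule tendsto_lowerbound)
      (use bound in \<open>auto simp: eventually_at_filter\<close>)
  then show ?thesis by simp
qed

lemma sqrt_F_le: "sqrt (F x) \<le> L * norm x"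
proof -
  have "sqrt (F x) \<le> sqrt ((G x)\<^sup>2)" using F_le_G by (rule real_sqrt_le_mono)
  also have "\<dots> = G x" using is_norm_nonneg[OF G_norm] by simp
  finally show ?thesis using G_upper order_trans by blast
qed

lemma sdiff_F_bound:
  assumes L: "L \<ge> 0"
  shows "sdiff F x h \<le> 4 * L\<^sup>2 * norm x * norm h + 2 * L\<^sup>2 * (norm h)\<^sup>2"
  using sdiff_norm_power2_le[OF is_norm_sqrt_F sqrt_F_le L, of x h] F_nonneg
  by (simp add: sdiff_def)

lemma F_subgradient:
  obtains f :: "'a \<Rightarrow>\<^sub>L real" where "\<And>h. F x + f h \<le> F (x + h)"
proof -
  let ?P = "\<lambda>x. sqrt (F x)"
  have "sublinear ?P"
    using is_norm_sqrt_F unfolding sublinear_def is_norm_def by simp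
  then obtain f :: "'a \<Rightarrow>\<^sub>L real" where f: "\<And>y. f y \<le> ?P y" "f x = ?P x"
    using hahn_banach_blinfun[OF _ sqrt_F_le] by blast
  have "F x + ((2 * ?P x) *\<^sub>R f) h \<le> F (x + h)" for h
  proof -
    have "\<bar>f (x + h)\<bar> \<le> ?P (x + h)"
      using f(1)[of "x + h"] f(1)[of "- (x + h)"] is_norm_minus[OF is_norm_sqrt_F, of "x + h"]
      unfolding blinfun.minus_right by (simp add: abs_le_iff)
    then have "(f (x + h))\<^sup>2 \<le> (?P (x + h))\<^sup>2" by (rule power2_le_iff_abs_le[THEN iffD2, rotated]) (simp add: F_nonneg)
    also have "\<dots> = F (x + h)" using F_nonneg by simp
    finally have "(?P x + f h)\<^sup>2 \<le> F (x + h)" using f(2) by (simp add: blinfun.add_right)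
    moreover have "(?P x)\<^sup>2 = F x" using F_nonneg by simp
    moreover have "(?P x + f h)\<^sup>2 = (?P x)\<^sup>2 + 2 * ?P x * f h + (f h)\<^sup>2" unfolding power2_sum by simp
    moreover have "((2 * ?P x) *\<^sub>R f) h = 2 * ?P x * f h" by (simp add: blinfun.scaleR_left)
    ultimately show ?thesis using zero_le_power2[of "f h"] by linarith
  qed
  then show thesis by (rule that)
qed

end

section \<open>Kernels of finitely many functionals\<close>

lemma finite_codim_kernel:
  fixes f :: "nat \<Rightarrow> 'a::real_normed_vector \<Rightarrow>\<^sub>L real"
  shows "\<exists>C B. C \<ge> 0 \<and> finite B \<and> (\<forall>v. \<exists>y. (\<forall>i<n. f i y = 0) \<and> v - y \<in> span B \<and>
    norm (v - y) \<le> C * (\<Sum>i<n. \<bar>f i v\<bar>))"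
proof (induction n)
  case 0
  show ?case by (rule exI[of _ 0], rule exI[of _ "{}"]) simp
next
  case (Suc n)
  then obtain C B where CB: "C \<ge> 0" "finite B" and
    ex: "\<And>v. \<exists>y. (\<forall>i<n. f i y = 0) \<and> v - y \<in> span B \<and> norm (v - y) \<le> C * (\<Sum>i<n. \<bar>f i v\<bar>)"
    by blast
  show ?case
  proof (cases "\<forall>y. (\<forall>i<n. f i y = 0) \<longrightarrow> f n y = 0")
    case True
    have "\<exists>y. (\<forall>i<Suc n. f i y = 0) \<and> v - y \<in> span B \<and> norm (v - y) \<le> C * (\<Sum>i<Suc n. \<bar>f i v\<bar>)" for v
    proof -
      obtain y where y: "\<forall>i<n. f i y = 0" "v - y \<in> span B" "norm (v - y) \<le> C * (\<Sum>i<n. \<bar>f i v\<bar>)"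
        using ex by blast
      have "C * (\<Sum>i<n. \<bar>f i v\<bar>) \<le> C * (\<Sum>i<Suc n. \<bar>f i v\<bar>)" using CB by (intro mult_left_mono) auto
      with y True show ?thesis by (intro exI[of _ y]) (auto simp: less_Suc_eq)
    qed
    then show ?thesis using CB by (intro exI[of _ C] exI[of _ B]) simp
  next
    case False
    then obtain e where e: "\<forall>i<n. f i e = 0" "f n e \<noteq> 0" by blast
    define D where "D = norm e / \<bar>f n e\<bar>"
    have D: "D \<ge> 0" unfolding D_def by simp
    have "\<exists>y. (\<forall>i<Suc n. f i y = 0) \<and> v - y \<in> span (insert e B) \<and>
        norm (v - y) \<le> (C + D * (1 + norm (f n) * C)) * (\<Sum>i<Suc n. \<bar>f i v\<bar>)" for v
    proof -
      define S where "S = (\<Sum>i<n. \<bar>f i v\<bar>)"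
      have S: "S \<ge> 0" unfolding S_def by (intro sum_nonneg) auto
      obtain y where y: "\<forall>i<n. f i y = 0" "v - y \<in> span B" "norm (v - y) \<le> C * S"
        using ex unfolding S_def by blast
      define y' where "y' = y - (f n y / f n e) *\<^sub>R e"
      have eq: "v - y' = (v - y) + (f n y / f n e) *\<^sub>R e" unfolding y'_def by simp
      have "\<forall>i<Suc n. f i y' = 0"
        using y e unfolding y'_def by (auto simp: less_Suc_eq blinfun.diff_right blinfun.scaleR_right)
      moreover have "v - y' \<in> span (insert e B)"
        unfolding eq using y(2) span_mono[of B "insert e B"]
        by (intro span_add span_scale) (auto intro: span_base)
      moreover have "norm (v - y') \<le> (C + D * (1 + norm (f n) * C)) * (\<Sum>i<Suc n. \<bar>f i v\<bar>)"
      proof -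
        have "f n y = f n v - f n (v - y)" by (simp add: blinfun.diff_right)
        moreover have "\<bar>f n (v - y)\<bar> \<le> norm (f n) * norm (v - y)" using norm_blinfun[of "f n" "v - y"] by simp
        moreover have "norm (f n) * norm (v - y) \<le> norm (f n) * (C * S)"
          using y(3) by (intro mult_left_mono) auto
        ultimately have fy: "\<bar>f n y\<bar> \<le> \<bar>f n v\<bar> + norm (f n) * (C * S)" by linarith
        have "norm (v - y') \<le> norm (v - y) + norm ((f n y / f n e) *\<^sub>R e)"
          unfolding eq by (rule norm_triangle_ineq)
        also have "norm ((f n y / f n e) *\<^sub>R e) = D * \<bar>f n y\<bar>" unfolding D_def by (simp add: abs_divide)
        also have "norm (v - y) + D * \<bar>f n y\<bar> \<le> C * S + D * (\<bar>f n v\<bar> + norm (f n) * (C * S))"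
          using y(3) fy D by (intro add_mono mult_left_mono) auto
        also have "\<dots> \<le> (C + D * (1 + norm (f n) * C)) * (S + \<bar>f n v\<bar>)"
        proof -
          have "0 \<le> C * \<bar>f n v\<bar>" "0 \<le> D * S" "0 \<le> D * (norm (f n) * C * \<bar>f n v\<bar>)"
            using CB D S by auto
          then show ?thesis by (simp add: algebra_simps)
        qed
        finally show ?thesis unfolding S_def by simp
      qed
      ultimately show ?thesis by blast
    qed
    moreover have "C + D * (1 + norm (f n) * C) \<ge> 0" using CB D by auto
    moreover have "finite (insert e B)" using CB(2) by simp
    ultimately show ?thesis
      by (intro exI[of _ "C + D * (1 + norm (f n) * C)"] exI[of _ "insert e B"] conjI allI)
  qed
qed

lemma finite_kernel_nontrivial:
  fixes f :: "nat \<Rightarrow> 'a::real_normed_vector \<Rightarrow>\<^sub>L real"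
  assumes "\<nexists>B :: 'a set. finite B \<and> span B = UNIV"
  shows "\<exists>z. z \<noteq> 0 \<and> (\<forall>i<n. f i z = 0)"
proof (rule ccontr)
  assume "\<not> ?thesis"
  then have triv: "y = 0" if "\<forall>i<n. f i y = 0" for y using that by blast
  obtain C B where B: "finite B" "\<forall>v. \<exists>y. (\<forall>i<n. f i y = 0) \<and> v - y \<in> span B \<and>
      norm (v - y) \<le> C * (\<Sum>i<n. \<bar>f i v\<bar>)"
    using finite_codim_kernel[of n f] by (elim exE conjE)
  have "v \<in> span B" for v
  proof -
    obtain y where "\<forall>i<n. f i y = 0" "v - y \<in> span B" using B(2) by blast
    then show ?thesis using triv by fastforce
  qed
  then show False using assms B(1) by blast
qed

lemma finite_functional_net:
  fixes g :: "nat \<Rightarrow> 'a \<Rightarrow> real"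
  assumes M: "\<And>i y. i < n \<Longrightarrow> y \<in> S \<Longrightarrow> \<bar>g i y\<bar> \<le> M" and e: "e > 0"
  shows "\<exists>W\<subseteq>S. finite W \<and> (\<forall>y\<in>S. \<exists>w\<in>W. \<forall>i<n. \<bar>g i y - g i w\<bar> < e)"
proof -
  define key where "key y = (\<lambda>i\<in>{..<n}. \<lfloor>g i y / e\<rfloor>)" for y
  have "key ` S \<subseteq> PiE {..<n} (\<lambda>_. {\<lfloor>- M / e\<rfloor>..\<lfloor>M / e\<rfloor>})"
  proof (rule image_subsetI)
    fix y assume y: "y \<in> S"
    have "\<lfloor>g i y / e\<rfloor> \<in> {\<lfloor>- M / e\<rfloor>..\<lfloor>M / e\<rfloor>}" if "i < n" for i
    proof -
      have "- M \<le> g i y" "g i y \<le> M" using M[OF that y] by auto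
      then have "- M / e \<le> g i y / e" "g i y / e \<le> M / e" 
        using e divide_right_mono[of "- M" "g i y" e] divide_right_mono[of "g i y" M e] by auto
      then show ?thesis by (simp only: atLeastAtMost_iff floor_mono)
    qed
    then show "key y \<in> PiE {..<n} (\<lambda>_. {\<lfloor>- M / e\<rfloor>..\<lfloor>M / e\<rfloor>})" unfolding key_def by auto
  qed
  then have "finite (key ` S)" by (rule finite_subset) (intro finite_PiE; simp)
  then obtain W where W: "W \<subseteq> S" "finite W" "key ` S = key ` W"
    using finite_subset_image[of "key ` S" key S] by blast
  have "\<exists>w\<in>W. \<forall>i<n. \<bar>g i y - g i w\<bar> < e" if "y \<in> S" for y
  proof -
    obtain w where w: "w \<in> W" "key y = key w" using W(3) \<open>y \<in> S\<close> by blast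
    have "\<bar>g i y - g i w\<bar> < e" if i: "i < n" for i
    proof -
      have "\<lfloor>g i y / e\<rfloor> = \<lfloor>g i w / e\<rfloor>" using fun_cong[OF w(2), of i] i unfolding key_def by simp
      then have "\<bar>g i y / e - g i w / e\<bar> < 1" by linarith
      then have "\<bar>g i y - g i w\<bar> / e < 1" using e by (simp add: abs_divide flip: diff_divide_distrib)
      then show ?thesis using e by simp
    qed
    then show ?thesis using w(1) by blast
  qed
  then show ?thesis using W by blast
qed

lemma quotient_net:
  fixes f :: "nat \<Rightarrow> 'a::real_normed_vector \<Rightarrow>\<^sub>L real"
  assumes e: "e > 0"
  shows "\<exists>W. finite W \<and> (\<forall>y. norm y \<le> 1 \<longrightarrow>
    (\<exists>w\<in>W. \<exists>y'. (\<forall>i<n. f i y' = 0) \<and> norm y' \<le> 2 + e \<and> norm (y - w - y') < e))"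
proof -
  obtain C where C: "C \<ge> 0"
    "\<And>v. \<exists>y. (\<forall>i<n. f i y = 0) \<and> norm (v - y) \<le> C * (\<Sum>i<n. \<bar>f i v\<bar>)"
    using finite_codim_kernel[of n f] by blast
  define d where "d = e / (C * real n + 1)"
  have d: "d > 0" "C * (real n * d) < e"
  proof -
    have pos: "C * real n + 1 > 0" using C(1) by (simp add: add_nonneg_pos)
    then show "d > 0" using e unfolding d_def by simp
    have "C * (real n * d) < d * (C * real n + 1)" using \<open>d > 0\<close> by (simp add: algebra_simps)
    also have "\<dots> = e" using pos unfolding d_def by simp
    finally show "C * (real n * d) < e" .
  qed
  have bound: "\<bar>f i y\<bar> \<le> (\<Sum>i<n. norm (f i))" if "i < n" "y \<in> cball 0 1" for i y
  proof -
    have "\<bar>f i y\<bar> \<le> norm (f i) * norm y" using norm_blinfun[of "f i" y] by simp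
    also have "\<dots> \<le> norm (f i)" using that(2) by (simp add: mult_left_le)
    also have "\<dots> \<le> (\<Sum>i<n. norm (f i))" using that(1) by (intro member_le_sum) auto
    finally show ?thesis .
  qed
  have "\<exists>W\<subseteq>cball 0 1. finite W \<and> (\<forall>y\<in>cball 0 1. \<exists>w\<in>W. \<forall>i<n. \<bar>f i y - f i w\<bar> < d)"
    using bound d(1) by (rule finite_functional_net)
  then obtain W where W: "W \<subseteq> cball 0 1" "finite W"
    "\<forall>y\<in>cball 0 1. \<exists>w\<in>W. \<forall>i<n. \<bar>f i y - f i w\<bar> < d"
    by blast
  have "\<exists>w\<in>W. \<exists>y'. (\<forall>i<n. f i y' = 0) \<and> norm y' \<le> 2 + e \<and> norm (y - w - y') < e"
    if y: "norm y \<le> 1" for y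
  proof -
    obtain w where w: "w \<in> W" "\<And>i. i < n \<Longrightarrow> \<bar>f i y - f i w\<bar> < d" using bspec[OF W(3), of y] y by auto
    obtain y' where y': "\<forall>i<n. f i y' = 0" "norm (y - w - y') \<le> C * (\<Sum>i<n. \<bar>f i (y - w)\<bar>)"
      using C(2) by blast
    have "(\<Sum>i<n. \<bar>f i (y - w)\<bar>) \<le> (\<Sum>i<n. d)"
      using w(2) by (intro sum_mono) (auto simp: blinfun.diff_right less_imp_le)
    then have "norm (y - w - y') \<le> C * (real n * d)"
      using y'(2) C(1) mult_left_mono[of "\<Sum>i<n. \<bar>f i (y - w)\<bar>" "real n * d" C] by simp
    then have small: "norm (y - w - y') < e" using d(2) by simp
    have "norm w \<le> 1" using W(1) w(1) by auto
    then have "norm (y - w) \<le> 2" using norm_triangle_ineq4[of y w] y by simp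
    moreover have "norm y' \<le> norm (y - w) + norm (y - w - y')"
      using norm_triangle_ineq4[of "y - w" "y - w - y'"] by simp
    ultimately have "norm y' \<le> 2 + e" using small by simp
    then show ?thesis using w(1) y'(1) small by blast
  qed
  then show ?thesis using W(2) by blast
qed

definition weighted_sq :: "(nat \<Rightarrow> 'a::real_normed_vector \<Rightarrow>\<^sub>L real) \<Rightarrow> 'a \<Rightarrow> real" where
  "weighted_sq f x = (\<Sum>i. (1/2) ^ Suc i * (f i x)\<^sup>2)"

context
  fixes f :: "nat \<Rightarrow> 'a::real_normed_vector \<Rightarrow>\<^sub>L real"
  assumes f_le: "\<And>i. norm (f i) \<le> 1"
begin

lemma weighted_sq_term_le: "(1/2) ^ Suc i * (f i x)\<^sup>2 \<le> (1/2) ^ Suc i * (norm x)\<^sup>2"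
proof -
  have "\<bar>f i x\<bar> \<le> norm (f i) * norm x" using norm_blinfun[of "f i" x] by simp
  also have "\<dots> \<le> 1 * norm x" using f_le by (intro mult_right_mono) auto
  finally show ?thesis using abs_le_square_iff[of "f i x" "norm x"] by simp
qed

lemma summable_weighted_sq: "summable (\<lambda>i. (1/2) ^ Suc i * (f i x)\<^sup>2)"
proof (rule summable_comparison_test')
  show "summable (\<lambda>i. (1/2::real) ^ Suc i * (norm x)\<^sup>2)"
    using power_half_series sums_summable summable_mult2 by blast
  show "norm ((1/2) ^ Suc i * (f i x)\<^sup>2) \<le> (1/2) ^ Suc i * (norm x)\<^sup>2" if "i \<ge> 0" for i
    using weighted_sq_term_le[of i x] by simp
qed

lemma weighted_sq_combination:
  "(\<Sum>i. u * ((1/2) ^ Suc i * (f i x)\<^sup>2) + v * ((1/2) ^ Suc i * (f i y)\<^sup>2))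
    = u * weighted_sq f x + v * weighted_sq f y"
  unfolding weighted_sq_def
  by (rule sums_unique[symmetric]) (intro sums_add sums_mult summable_sums summable_weighted_sq)

lemma weighted_sq_nonneg: "weighted_sq f x \<ge> 0"
  unfolding weighted_sq_def by (intro suminf_nonneg summable_weighted_sq) simp

lemma weighted_sq_ge_term: "(1/2) ^ Suc i * (f i x)\<^sup>2 \<le> weighted_sq f x"
  unfolding weighted_sq_def
  using sum_le_suminf[OF summable_weighted_sq, of "{i}" x] by simp

lemma weighted_sq_kernel_le:
  assumes z: "\<And>i. i < n \<Longrightarrow> f i z = 0"
  shows "weighted_sq f z \<le> (1/2) ^ n * (norm z)\<^sup>2"
proof -
  have s: "(\<lambda>i. (1/2) ^ n * ((1/2::real) ^ Suc i) * (norm z)\<^sup>2) sums ((1/2) ^ n * 1 * (norm z)\<^sup>2)"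
    by (intro sums_mult sums_mult2 power_half_series)
  have "weighted_sq f z = (\<Sum>i. (1/2) ^ Suc (i + n) * (f (i + n) z)\<^sup>2)"
    unfolding weighted_sq_def
    using suminf_split_initial_segment[OF summable_weighted_sq[of z], of n] z by simp
  also have "\<dots> \<le> (\<Sum>i. (1/2) ^ n * ((1/2::real) ^ Suc i) * (norm z)\<^sup>2)"
  proof (rule suminf_le)
    show "(1/2) ^ Suc (i + n) * (f (i + n) z)\<^sup>2 \<le> (1/2) ^ n * ((1/2::real) ^ Suc i) * (norm z)\<^sup>2" for i
      using weighted_sq_term_le[of "i + n" z] by (simp add: power_add mult_ac)
    show "summable (\<lambda>i. (1/2) ^ Suc (i + n) * (f (i + n) z)\<^sup>2)"
      using summable_ignore_initial_segment[OF summable_weighted_sq[of z], of n] .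
    show "summable (\<lambda>i. (1/2) ^ n * ((1/2::real) ^ Suc i) * (norm z)\<^sup>2)" using s sums_summable by blast
  qed
  also have "\<dots> = (1/2) ^ n * (norm z)\<^sup>2" using sums_unique[OF s] by simp
  finally show ?thesis .
qed

lemma weighted_sq_le: "weighted_sq f x \<le> (norm x)\<^sup>2"
  using weighted_sq_kernel_le[of 0 x] by simp

lemma weighted_sq_parallelogram:
  "weighted_sq f (x + y) + weighted_sq f (x - y) = 2 * weighted_sq f x + 2 * weighted_sq f y"
proof -
  have "weighted_sq f (x + y) + weighted_sq f (x - y)
      = (\<Sum>i. (1/2) ^ Suc i * (f i (x + y))\<^sup>2 + (1/2) ^ Suc i * (f i (x - y))\<^sup>2)"
    unfolding weighted_sq_def by (intro suminf_add summable_weighted_sq)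
  also have "\<dots> = (\<Sum>i. 2 * ((1/2) ^ Suc i * (f i x)\<^sup>2) + 2 * ((1/2) ^ Suc i * (f i y)\<^sup>2))"
    by (intro suminf_cong)
      (simp only: blinfun.add_right blinfun.diff_right power2_sum power2_diff, simp add: field_simps)
  also have "\<dots> = 2 * weighted_sq f x + 2 * weighted_sq f y"
    by (rule weighted_sq_combination)
  finally show ?thesis .
qed

lemma weighted_sq_scale: "weighted_sq f (c *\<^sub>R x) = c\<^sup>2 * weighted_sq f x"
proof -
  have "weighted_sq f (c *\<^sub>R x) = (\<Sum>i. c\<^sup>2 * ((1/2) ^ Suc i * (f i x)\<^sup>2))"
    unfolding weighted_sq_def
    by (intro suminf_cong) (simp add: blinfun.scaleR_right power_mult_distrib)
  then show ?thesis unfolding weighted_sq_def by (simp only: suminf_mult summable_weighted_sq)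
qed

lemma weighted_sq_convex: "convex_on UNIV (weighted_sq f)"
  unfolding convex_on_def
proof (intro conjI ballI allI impI)
  fix x y :: 'a and u v :: real assume uv: "0 \<le> u" "0 \<le> v" "u + v = 1"
  have "weighted_sq f (u *\<^sub>R x + v *\<^sub>R y)
      \<le> (\<Sum>i. u * ((1/2) ^ Suc i * (f i x)\<^sup>2) + v * ((1/2) ^ Suc i * (f i y)\<^sup>2))"
    unfolding weighted_sq_def
  proof (rule suminf_le)
    show "summable (\<lambda>i. (1/2) ^ Suc i * (f i (u *\<^sub>R x + v *\<^sub>R y))\<^sup>2)"
      by (rule summable_weighted_sq)
    show "summable (\<lambda>i. u * ((1/2) ^ Suc i * (f i x)\<^sup>2) + v * ((1/2) ^ Suc i * (f i y)\<^sup>2))"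
      by (rule summable_add[OF summable_mult[OF summable_weighted_sq] summable_mult[OF summable_weighted_sq]])
    fix i
    have "(f i (u *\<^sub>R x + v *\<^sub>R y))\<^sup>2 \<le> u * (f i x)\<^sup>2 + v * (f i y)\<^sup>2"
      using is_norm_power2_convex[OF is_norm_norm uv, of "f i x" "f i y"]
      by (simp add: blinfun.add_right blinfun.scaleR_right)
    then have "(1/2) ^ Suc i * (f i (u *\<^sub>R x + v *\<^sub>R y))\<^sup>2
        \<le> (1/2) ^ Suc i * (u * (f i x)\<^sup>2 + v * (f i y)\<^sup>2)"
      by (intro mult_left_mono) auto
    then show "(1/2) ^ Suc i * (f i (u *\<^sub>R x + v *\<^sub>R y))\<^sup>2
        \<le> u * ((1/2) ^ Suc i * (f i x)\<^sup>2) + v * ((1/2) ^ Suc i * (f i y)\<^sup>2)"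
      by (simp add: algebra_simps)
  qed
  also have "\<dots> = u * weighted_sq f x + v * weighted_sq f y"
    by (rule weighted_sq_combination)
  finally show "weighted_sq f (u *\<^sub>R x + v *\<^sub>R y) \<le> u * weighted_sq f x + v * weighted_sq f y" .
qed simp

end

section \<open>The renorming\<close>

lemma tendsto_zero_power2_cancel:
  fixes g :: "'b \<Rightarrow> real"
  assumes "((\<lambda>n. (g n)\<^sup>2) \<longlongrightarrow> 0) A"
  shows "(g \<longlongrightarrow> 0) A"
proof -
  have "((\<lambda>n. sqrt ((g n)\<^sup>2)) \<longlongrightarrow> sqrt 0) A" using assms by (rule tendsto_real_sqrt)
  then show ?thesis by (simp add: tendsto_rabs_zero_iff)
qed

locale renorming =
  fixes f :: "nat \<Rightarrow> 'a::real_normed_vector \<Rightarrow>\<^sub>L real" and x :: "nat \<Rightarrow> 'a" and \<eta> :: real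
  assumes infinite_dim: "\<nexists>B :: 'a set. finite B \<and> span B = UNIV"
    and f_le: "\<And>i. norm (f i) \<le> 1" and f_sep: "\<And>v. (\<And>i. f i v = 0) \<Longrightarrow> v = 0"
    and x_dense: "closure (span (range x)) = UNIV"
    and f_x0: "f 0 (x 0) \<noteq> 0" and f_x: "\<And>i. f 0 (x (Suc i)) = 0"
    and \<eta>_pos: "\<eta> > 0"
begin

definition \<phi> :: "'a \<Rightarrow>\<^sub>L real" where
  "\<phi> = ((1 + \<eta> / 2) / norm (f 0)) *\<^sub>R f 0"

definition G :: "'a \<Rightarrow> real" where
  "G v = max (norm v) \<bar>\<phi> v\<bar>"

definition K :: "nat \<Rightarrow> 'a set" where
  "K n = (if even n then range (\<lambda>c. c *\<^sub>R x (n div 2)) else {y. \<forall>i<Suc (n div 2). f i y = 0})"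

definition a :: "nat \<Rightarrow> real" where
  "a n = 2 ^ Suc n / \<eta>"

lemma norm_\<phi>: "norm \<phi> = 1 + \<eta> / 2"
proof -
  have "f 0 \<noteq> 0" using f_x0 by auto
  then show ?thesis unfolding \<phi>_def using \<eta>_pos by simp
qed

lemma \<phi>_eq: "\<phi> v = (1 + \<eta> / 2) / norm (f 0) * f 0 v"
  unfolding \<phi>_def by (simp add: blinfun.scaleR_left)

sublocale inf_convolution G K a \<eta> "1 + \<eta> / 2"
proof
  have tri: "G (v + w) \<le> G v + G w" for v w
  proof -
    have "norm (v + w) \<le> norm v + norm w" by (rule norm_triangle_ineq)
    moreover have "\<bar>\<phi> (v + w)\<bar> \<le> \<bar>\<phi> v\<bar> + \<bar>\<phi> w\<bar>" by (simp add: blinfun.add_right)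
    ultimately show ?thesis unfolding G_def by linarith
  qed
  have zero: "G v = 0 \<longleftrightarrow> v = 0" for v
    unfolding G_def by (auto simp: blinfun.zero_right max_def)
  have scale: "G (c *\<^sub>R v) = \<bar>c\<bar> * G v" for c v
    unfolding G_def by (simp add: blinfun.scaleR_right abs_mult max_mult_distrib_left)
  show "is_norm G" unfolding is_norm_def using tri zero scale by blast
  show "norm v \<le> G v" for v unfolding G_def by simp
  show "G v \<le> (1 + \<eta> / 2) * norm v" for v
    using norm_blinfun[of \<phi> v] \<eta>_pos unfolding norm_\<phi> G_def by (simp add: algebra_simps)
  show "subspace (K i)" for i
  proof (cases "even i")
    case True
    have "K i = span {x (i div 2)}" using True unfolding K_def span_singleton by simp
    then show ?thesis by simp
  next
    case False
    then show ?thesis unfolding K_def subspace_def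
      by (auto simp: blinfun.zero_right blinfun.add_right blinfun.scaleR_right)
  qed
  show "a i > 0" for i unfolding a_def using \<eta>_pos by simp
  show "(\<Sum>i\<in>A. 1 / a i) \<le> \<eta>" if "finite A" for A
  proof -
    have "(\<Sum>i\<in>A. (1 / 2 :: real) ^ Suc i) \<le> (\<Sum>i. (1 / 2) ^ Suc i)"
      using power_half_series sums_summable that by (intro sum_le_suminf) auto
    then have "(\<Sum>i\<in>A. (1 / 2 :: real) ^ Suc i) \<le> 1" using sums_unique[OF power_half_series] by simp
    then have "\<eta> * (\<Sum>i\<in>A. (1 / 2 :: real) ^ Suc i) \<le> \<eta> * 1" using \<eta>_pos by (intro mult_left_mono) auto
    then show ?thesis unfolding a_def sum_distrib_left by (simp add: power_divide)
  qed
  show "\<eta> > 0" by (rule \<eta>_pos)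
qed

abbreviation "\<rho> \<equiv> weighted_sq f"

definition Q :: "'a \<Rightarrow> real" where
  "Q v = F v + \<eta> * \<rho> v"

definition N :: "'a \<Rightarrow> real" where
  "N v = sqrt (Q v)"

lemma \<rho>_nonneg: "\<rho> v \<ge> 0"
  by (rule weighted_sq_nonneg[of f, OF f_le])

lemma F_le_Q: "F v \<le> Q v"
  unfolding Q_def using \<rho>_nonneg \<eta>_pos by simp

lemma Q_nonneg: "Q v \<ge> 0"
  using F_le_Q F_nonneg order_trans by blast

lemma N_power2: "(N v)\<^sup>2 = Q v"
  unfolding N_def using Q_nonneg by simp

lemma is_norm_N: "is_norm N"
  unfolding N_def
proof (rule is_norm_sqrt)
  show "convex_on UNIV Q" unfolding Q_def
    using F_convex weighted_sq_convex[of f, OF f_le] \<eta>_pos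
    by (intro convex_on_add convex_on_cmul) auto
  show "Q (c *\<^sub>R v) = c\<^sup>2 * Q v" for c v
    unfolding Q_def F_scale weighted_sq_scale[of f, OF f_le] by (simp add: algebra_simps)
  show "Q v > 0" if "v \<noteq> 0" for v using F_pos[OF that] F_le_Q order_less_le_trans by blast
qed

lemma N_nonneg: "N v \<ge> 0"
  by (rule is_norm_nonneg[OF is_norm_N])

lemma N_add: "N (v + w) \<le> N v + N w" and N_scale: "N (c *\<^sub>R v) = \<bar>c\<bar> * N v"
  and N_eq_0: "N v = 0 \<longleftrightarrow> v = 0"
  using is_norm_N by (simp_all add: is_norm_def)

lemma norm_le_N: "norm v \<le> (1 + \<eta>) * N v"
proof -
  have "(norm v)\<^sup>2 \<le> (1 + \<eta>) * F v" by (rule norm_le_F)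
  also have "\<dots> \<le> (1 + \<eta>) * Q v" using F_le_Q \<eta>_pos by (intro mult_left_mono) auto
  also have "\<dots> \<le> (1 + \<eta>) * ((1 + \<eta>) * Q v)"
    using Q_nonneg[of v] \<eta>_pos by (intro mult_left_mono) (auto simp: algebra_simps)
  also have "\<dots> = ((1 + \<eta>) * N v)\<^sup>2" by (simp only: power_mult_distrib N_power2 power2_eq_square[of "1 + \<eta>"] mult.assoc)
  finally show ?thesis by (rule power2_le_imp_le) (use N_nonneg \<eta>_pos in simp)
qed

lemma N_le_norm: "N v \<le> (1 + \<eta>) * norm v"
proof -
  have "Q v \<le> ((1 + \<eta> / 2) * norm v)\<^sup>2 + \<eta> * (norm v)\<^sup>2"
  proof -
    have "F v \<le> (G v)\<^sup>2" by (rule F_le_G)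
    also have "\<dots> \<le> ((1 + \<eta> / 2) * norm v)\<^sup>2"
      using G_upper is_norm_nonneg[OF G_norm] by (intro power_mono)
    finally show ?thesis unfolding Q_def
      using weighted_sq_le[of f, OF f_le, of v] \<eta>_pos by (intro add_mono mult_left_mono) auto
  qed
  also have "\<dots> = ((1 + \<eta>) * norm v)\<^sup>2 - 3 / 4 * (\<eta> * norm v)\<^sup>2"
    by (simp add: power2_eq_square algebra_simps)
  also have "\<dots> \<le> ((1 + \<eta>) * norm v)\<^sup>2" by simp
  finally have "(N v)\<^sup>2 \<le> ((1 + \<eta>) * norm v)\<^sup>2" unfolding N_power2 .
  then show ?thesis by (rule power2_le_imp_le) (use \<eta>_pos in simp)
qed

lemma norm_close_N: "norm_close \<eta> N"
  unfolding norm_close_def using norm_le_N N_le_norm \<eta>_pos by (simp add: field_simps)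

lemma equivalent_norm_N: "equivalent_norm N"
  unfolding equivalent_norm_def
  using is_norm_N norm_close_N \<eta>_pos unfolding norm_close_def
  by (intro conjI exI[of _ "inverse (1 + \<eta>)"] exI[of _ "1 + \<eta>"]) auto

lemma Q_midpoint: "Q (u + v) + \<eta> * \<rho> (u - v) \<le> 2 * Q u + 2 * Q v"
proof -
  have "F (u + v) = 4 * F ((1/2) *\<^sub>R (u + v))" unfolding F_scale by (simp add: power2_eq_square)
  also have "\<dots> \<le> 2 * F u + 2 * F v" using convex_midpoint[OF F_convex, of u v] by simp
  finally have "F (u + v) \<le> 2 * F u + 2 * F v" .
  moreover have "\<eta> * \<rho> (u + v) + \<eta> * \<rho> (u - v) = \<eta> * (2 * \<rho> u + 2 * \<rho> v)"
    unfolding weighted_sq_parallelogram[of f, OF f_le, of u v, symmetric] by (rule distrib_left[symmetric])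
  ultimately show ?thesis unfolding Q_def by (simp add: algebra_simps)
qed

lemma rotund_N: "rotund N"
  unfolding rotund_def unit_sphere_def unit_ball_def
proof (intro ballI impI)
  fix v y z assume v: "v \<in> {v. N v = 1}" and y: "y \<in> {v. N v \<le> 1}" and z: "z \<in> {v. N v \<le> 1}"
    and eq: "2 *\<^sub>R v = y + z"
  have "N (y + z) = 2" using N_scale[of 2 v] v unfolding eq by simp
  then have "Q (y + z) = 4" using N_power2[of "y + z"] by simp
  moreover have "Q y \<le> 1" "Q z \<le> 1"
    using y z N_nonneg N_power2 by (simp_all flip: N_power2 add: power_le_one)
  ultimately have "\<eta> * \<rho> (y - z) \<le> 0" using Q_midpoint[of y z] by simp
  then have \<rho>0: "\<rho> (y - z) \<le> 0" using \<eta>_pos by (simp add: mult_le_0_iff)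
  have "f i (y - z) = 0" for i
  proof -
    have "(1/2) ^ Suc i * (f i (y - z))\<^sup>2 \<le> 0"
      using weighted_sq_ge_term[of f, OF f_le, of i "y - z"] \<rho>0 by linarith
    moreover have "(1/2::real) ^ Suc i > 0" by simp
    ultimately have "(f i (y - z))\<^sup>2 \<le> 0" by (metis mult_le_0_iff not_le)
    then show ?thesis by simp
  qed
  then have "y = z" using f_sep[of "y - z"] by simp
  moreover from this have "v = y" using eq by (simp flip: scaleR_2)
  ultimately show "v = y \<and> y = z" by simp
qed

lemma weakly_uniformly_rotund_N:
  assumes dense: "\<And>g e. e > 0 \<Longrightarrow> \<exists>i c. norm (g - c *\<^sub>R f i) < e"
  shows "weakly_uniformly_rotund N"
  unfolding weakly_uniformly_rotund_def
proof (intro allI impI)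
  fix u v :: "nat \<Rightarrow> 'a"
  assume u: "\<forall>n. u n \<in> unit_sphere N" and v: "\<forall>n. v n \<in> unit_sphere N"
    and lim: "(\<lambda>n. N (u n + v n)) \<longlonglongrightarrow> 2"
  have N1: "N (u n) = 1" "N (v n) = 1" for n using u v unfolding unit_sphere_def by auto
  have Q1: "Q (u n) = 1" "Q (v n) = 1" for n using N1 by (simp_all flip: N_power2)
  have "(\<lambda>n. (4 - (N (u n + v n))\<^sup>2) / \<eta>) \<longlonglongrightarrow> (4 - 2\<^sup>2) / \<eta>"
    using \<eta>_pos by (intro tendsto_intros lim) simp
  then have lim0: "(\<lambda>n. (4 - (N (u n + v n))\<^sup>2) / \<eta>) \<longlonglongrightarrow> 0" by simp
  have \<rho>_le: "\<rho> (u n - v n) \<le> (4 - (N (u n + v n))\<^sup>2) / \<eta>" for n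
    using Q_midpoint[of "u n" "v n"] Q1[of n] \<eta>_pos unfolding N_power2 by (simp add: field_simps)
  have \<rho>_lim: "(\<lambda>n. \<rho> (u n - v n)) \<longlonglongrightarrow> 0"
    by (rule tendsto_sandwich[OF _ _ tendsto_const lim0]) (use \<rho>_nonneg \<rho>_le in auto)
  have f_lim: "(\<lambda>n. f i (u n - v n)) \<longlonglongrightarrow> 0" for i
  proof -
    have "(\<lambda>n. 2 ^ Suc i * \<rho> (u n - v n)) \<longlonglongrightarrow> 2 ^ Suc i * 0"
      by (intro tendsto_intros \<rho>_lim)
    then have l: "(\<lambda>n. 2 ^ Suc i * \<rho> (u n - v n)) \<longlonglongrightarrow> 0" by simp
    have "(f i w)\<^sup>2 \<le> 2 ^ Suc i * \<rho> w" for w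
      using weighted_sq_ge_term[of f, OF f_le, of i w] by (simp add: field_simps)
    then have "(\<lambda>n. (f i (u n - v n))\<^sup>2) \<longlonglongrightarrow> 0"
      by (intro tendsto_sandwich[OF _ _ tendsto_const l]) auto
    then show ?thesis by (rule tendsto_zero_power2_cancel)
  qed
  have bnd: "norm (u n - v n) \<le> 2 * (1 + \<eta>)" for n
    using norm_triangle_ineq4[of "u n" "v n"] norm_le_N[of "u n"] norm_le_N[of "v n"] N1[of n] by simp
  show "limitin weak_topology (\<lambda>n. u n - v n) 0 sequentially"
    unfolding limitin_weak_topology
  proof
    fix g :: "'a \<Rightarrow>\<^sub>L real"
    have "(\<lambda>n. g (u n - v n)) \<longlonglongrightarrow> 0"
    proof (rule LIMSEQ_I)
      fix e :: real assume e: "e > 0"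
      then have "e / (4 * (1 + \<eta>)) > 0" using \<eta>_pos by simp
      then obtain i c where ic: "norm (g - c *\<^sub>R f i) < e / (4 * (1 + \<eta>))" using dense by blast
      have "(\<lambda>n. c * f i (u n - v n)) \<longlonglongrightarrow> c * 0" by (intro tendsto_intros f_lim)
      then obtain n0 where n0: "\<And>n. n \<ge> n0 \<Longrightarrow> \<bar>c * f i (u n - v n)\<bar> < e / 2"
        using LIMSEQ_D[of "\<lambda>n. c * f i (u n - v n)" "c * 0" "e / 2"] e by auto
      have "norm (g (u n - v n) - 0) < e" if n: "n \<ge> n0" for n
      proof -
        have "g (u n - v n) = (g - c *\<^sub>R f i) (u n - v n) + c * f i (u n - v n)"
          by (simp add: blinfun.diff_left blinfun.scaleR_left)
        moreover have "\<bar>(g - c *\<^sub>R f i) (u n - v n)\<bar> \<le> e / 2"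
        proof -
          have "\<bar>(g - c *\<^sub>R f i) (u n - v n)\<bar> \<le> norm (g - c *\<^sub>R f i) * norm (u n - v n)"
            using norm_blinfun[of "g - c *\<^sub>R f i" "u n - v n"] by simp
          also have "\<dots> \<le> e / (4 * (1 + \<eta>)) * (2 * (1 + \<eta>))"
            using ic bnd[of n] \<eta>_pos e by (intro mult_mono) auto
          also have "\<dots> = e / 2" using \<eta>_pos by (simp add: field_simps)
          finally show ?thesis .
        qed
        ultimately show ?thesis using n0[OF n] by simp
      qed
      then show "\<exists>n0. \<forall>n\<ge>n0. norm (g (u n - v n) - 0) < e" by blast
    qed
    then show "(\<lambda>n. g (u n - v n)) \<longlonglongrightarrow> g 0" by (simp add: blinfun.zero_right)
  qed
qed

lemma smooth_directions_F: "w \<in> smooth_directions F v"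
proof -
  have L: "1 + \<eta> / 2 \<ge> 0" using \<eta>_pos by simp
  have cl: "closed (smooth_directions F v)"
    by (rule closed_smooth_directions[OF F_convex _ _ sdiff_F_bound[OF L]]) auto
  have "x i \<in> smooth_directions F v" for i
    unfolding smooth_directions_def
  proof (intro CollectI allI impI)
    fix e :: real assume e: "e > 0"
    define M where "M = 2 * a (2 * i) * (norm (x i))\<^sup>2"
    have M: "M \<ge> 0" unfolding M_def using a_pos[of "2 * i"] by simp
    have K: "K (2 * i) = range (\<lambda>c. c *\<^sub>R x i)" unfolding K_def by simp
    have "sdiff F v (t *\<^sub>R x i) \<le> e * t" if t: "0 < t" "t < e / (M + 1)" for t
    proof -
      have "sdiff F v (t *\<^sub>R x i) \<le> 2 * a (2 * i) * (norm (t *\<^sub>R x i))\<^sup>2"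
        by (rule sdiff_F_line[OF K]) (unfold K, rule rangeI)
      also have "\<dots> = (M * t) * t" unfolding M_def by (simp add: power2_eq_square)
      also have "\<dots> \<le> e * t" using t M by (intro mult_right_mono) (auto simp: field_simps)
      finally show ?thesis .
    qed
    then show "\<exists>\<tau>>0. \<forall>t. 0 < t \<and> t < \<tau> \<longrightarrow> sdiff F v (t *\<^sub>R x i) \<le> e * t"
      using e M by (intro exI[of _ "e / (M + 1)"]) auto
  qed
  then have "span (range x) \<subseteq> smooth_directions F v"
    using subspace_smooth_directions[OF F_convex] by (intro span_minimal) auto
  then have "closure (span (range x)) \<subseteq> smooth_directions F v" using cl closure_minimal by blast
  then show ?thesis using x_dense by auto
qed

lemma difference_quotient_N:
  assumes v: "N v = 1" and e: "sdiff F v (\<bar>h\<bar> *\<^sub>R y) \<le> e * \<bar>h\<bar>" and h: "h \<noteq> 0"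
  shows "\<bar>(N (v + h *\<^sub>R y) + N (v - h *\<^sub>R y) - 2) / h\<bar> \<le> e / 2 + \<eta> * \<bar>h\<bar> * \<rho> y"
proof -
  let ?p = "N (v + h *\<^sub>R y)" and ?m = "N (v - h *\<^sub>R y)"
  have "N ((v + h *\<^sub>R y) + (v - h *\<^sub>R y)) = 2" using N_scale[of 2 v] v by (simp add: scaleR_2)
  then have low: "?p + ?m - 2 \<ge> 0" using N_add[of "v + h *\<^sub>R y" "v - h *\<^sub>R y"] by simp
  have "Q v = 1" using v N_power2[of v] by simp
  have "2 * ?p \<le> ?p\<^sup>2 + 1" "2 * ?m \<le> ?m\<^sup>2 + 1"
    using zero_le_power2[of "?p - 1"] zero_le_power2[of "?m - 1"] by (simp_all add: power2_diff)
  then have "2 * (?p + ?m - 2) \<le> sdiff Q v (h *\<^sub>R y)"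
    unfolding sdiff_def N_power2 using \<open>Q v = 1\<close> by simp
  also have "\<dots> = sdiff F v (h *\<^sub>R y) + \<eta> * (\<rho> (v + h *\<^sub>R y) + \<rho> (v - h *\<^sub>R y) - 2 * \<rho> v)"
    unfolding sdiff_def Q_def by (simp add: algebra_simps)
  also have "\<dots> = sdiff F v (h *\<^sub>R y) + \<eta> * (2 * (h\<^sup>2 * \<rho> y))"
    using weighted_sq_parallelogram[of f, OF f_le, of v "h *\<^sub>R y"] weighted_sq_scale[of f, OF f_le, of h y] by simp
  also have "\<dots> \<le> e * \<bar>h\<bar> + \<eta> * (2 * (h\<^sup>2 * \<rho> y))"
    using e sdiff_abs[of F v h y] by simp
  also have "\<dots> = 2 * ((e / 2 + \<eta> * \<bar>h\<bar> * \<rho> y) * \<bar>h\<bar>)"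
    by (simp add: power2_eq_square algebra_simps)
  finally have "?p + ?m - 2 \<le> (e / 2 + \<eta> * \<bar>h\<bar> * \<rho> y) * \<bar>h\<bar>" by simp
  then show ?thesis using low h by (simp add: abs_divide pos_divide_le_eq)
qed

lemma gateaux_smooth_N: "gateaux_smooth N"
  unfolding gateaux_smooth_def
proof (intro ballI tendstoI)
  fix v y and e :: real
  assume v: "v \<in> unit_sphere N" and e: "e > 0"
  have v1: "N v = 1" using v unfolding unit_sphere_def by simp
  obtain \<tau> where \<tau>: "\<tau> > 0" "\<And>t. 0 < t \<Longrightarrow> t < \<tau> \<Longrightarrow> sdiff F v (t *\<^sub>R y) \<le> e * t"
    using smooth_directions_F[of y v] e unfolding smooth_directions_def by blast
  define d where "d = min \<tau> (e / (2 * (\<eta> * \<rho> y + 1)))"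
  have pos: "\<eta> * \<rho> y \<ge> 0" using \<eta>_pos \<rho>_nonneg by simp
  have "d > 0" unfolding d_def using \<tau> e pos by simp
  moreover have "dist ((N (v + h *\<^sub>R y) + N (v - h *\<^sub>R y) - 2) / h) 0 < e" if h: "h \<noteq> 0" "\<bar>h\<bar> < d" for h
  proof -
    have "\<bar>h\<bar> * (2 * (\<eta> * \<rho> y + 1)) < e" using h pos unfolding d_def by (simp add: pos_less_divide_eq)
    then have "\<eta> * \<bar>h\<bar> * \<rho> y < e / 2" using h by (simp add: algebra_simps)
    moreover have "sdiff F v (\<bar>h\<bar> *\<^sub>R y) \<le> e * \<bar>h\<bar>" using \<tau>(2)[of "\<bar>h\<bar>"] h unfolding d_def by simp
    ultimately show ?thesis using difference_quotient_N[OF v1 _ h(1), of y e] by (simp add: dist_real_def)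
  qed
  ultimately show "\<forall>\<^sub>F h in at 0. dist ((N (v + h *\<^sub>R y) + N (v - h *\<^sub>R y) - 2) / h) 0 < e"
    unfolding eventually_at by (intro exI[of _ d]) (auto simp: dist_real_def)
qed

text \<open>Modulo the common kernel of finitely many \<open>f i\<close> the unit ball is totally bounded, so
  only finitely many directions have to be controlled; on that kernel a subgradient of \<open>F\<close> is
  small.\<close>

lemma F_uniformly_smooth:
  assumes dense: "\<And>g e. e > 0 \<Longrightarrow> \<exists>i c. norm (g - c *\<^sub>R f i) < e" and e: "e > 0"
  shows "\<exists>\<tau>>0. \<forall>h. norm h < \<tau> \<longrightarrow> sdiff F v h \<le> e * norm h"
proof -
  define A B where "A = 4 * (1 + \<eta> / 2)\<^sup>2 * norm v" and "B = 2 * (1 + \<eta> / 2)\<^sup>2"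
  have AB: "A \<ge> 0" "B \<ge> 0" unfolding A_def B_def by auto
  have bound: "sdiff F v h \<le> A * norm h + B * (norm h)\<^sup>2" for h
    unfolding A_def B_def by (rule sdiff_F_bound) (use \<eta>_pos in simp)
  obtain g :: "'a \<Rightarrow>\<^sub>L real" where g: "\<And>h. F v + g h \<le> F (v + h)" using F_subgradient[of v] by blast
  define d where "d = e / 48"
  have d: "d > 0" unfolding d_def using e by simp
  obtain i c where ic: "norm (g - c *\<^sub>R f i) < d" using dense[OF d] by blast
  define m where "m = Suc (2 * i)"
  have K: "K m = {y. \<forall>j<Suc i. f j y = 0}" unfolding K_def m_def by simp
  have gK: "g y \<le> d * norm y" if "y \<in> K m" for y
  proof -
    have "g y = (g - c *\<^sub>R f i) y" using that unfolding K by (simp add: blinfun.diff_left blinfun.scaleR_left)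
    also have "\<dots> \<le> norm (g - c *\<^sub>R f i) * norm y" using norm_blinfun[of "g - c *\<^sub>R f i" y] by simp
    also have "\<dots> \<le> d * norm y" using ic by (intro mult_right_mono) auto
    finally show ?thesis .
  qed
  have sK: "sdiff F v h \<le> 4 * d * norm h + 2 * a m * (norm h)\<^sup>2" if "h \<in> K m" for h
    by (rule sdiff_F_subgradient[OF _ g _ gK that])
      (use d in \<open>auto intro: bounded_linear.linear blinfun.bounded_linear_right\<close>)
  define s where "s = min 1 (e / (8 * (A + 1)))"
  have s: "s > 0" "s \<le> 1" "A * s \<le> e / 8"
  proof -
    show "s > 0" "s \<le> 1" using e AB unfolding s_def by auto
    have "A * s \<le> A * (e / (8 * (A + 1)))" using AB unfolding s_def by (intro mult_left_mono) auto
    also have "\<dots> \<le> e / 8" using e AB by (simp add: field_simps)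
    finally show "A * s \<le> e / 8" .
  qed
  obtain W where W: "finite W" "\<forall>y. norm y \<le> 1 \<longrightarrow>
    (\<exists>w\<in>W. \<exists>y'. (\<forall>j<Suc i. f j y' = 0) \<and> norm y' \<le> 2 + s \<and> norm (y - w - y') < s)"
    using quotient_net[OF s(1), of "Suc i" f] by (elim exE conjE)
  have "e / 4 > 0" using e by simp
  have "\<forall>w\<in>W. \<exists>\<tau>>0. \<forall>t. 0 < t \<and> t < \<tau> \<longrightarrow> sdiff F v (t *\<^sub>R w) \<le> e / 4 * t"
  proof
    fix w
    show "\<exists>\<tau>>0. \<forall>t. 0 < t \<and> t < \<tau> \<longrightarrow> sdiff F v (t *\<^sub>R w) \<le> e / 4 * t"
      using smooth_directions_F[of w v] \<open>e / 4 > 0\<close> unfolding smooth_directions_def by blast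
  qed
  from bchoice[OF this] obtain T
    where T: "\<forall>w\<in>W. T w > 0 \<and> (\<forall>t. 0 < t \<and> t < T w \<longrightarrow> sdiff F v (t *\<^sub>R w) \<le> e / 4 * t)"
    by (elim exE)
  define \<tau>0 where "\<tau>0 = Min (insert 1 (T ` W))"
  have \<tau>0: "\<tau>0 > 0" "\<And>w. w \<in> W \<Longrightarrow> \<tau>0 \<le> T w"
    unfolding \<tau>0_def using W(1) T by auto
  define \<tau> where "\<tau> = min (\<tau>0 / 2) (min (e / (288 * a m)) (e / (32 * (B + 1))))"
  have "\<tau> > 0" unfolding \<tau>_def using \<tau>0 e AB a_pos[of m] by simp
  moreover have "sdiff F v h \<le> e * norm h" if h: "norm h < \<tau>" for h
  proof (cases "h = 0")
    case True
    then show ?thesis by (simp add: sdiff_def)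
  next
    case False
    define t where "t = norm h"
    have t: "t > 0" using False unfolding t_def by simp
    have t_le: "2 * t < \<tau>0" "t * (288 * a m) \<le> e" "t * (32 * (B + 1)) \<le> e"
      using h a_pos[of m] AB unfolding \<tau>_def t_def by (simp_all add: pos_less_divide_eq less_imp_le)
    define y where "y = inverse t *\<^sub>R h"
    have "norm y \<le> 1" unfolding y_def t_def using False by simp
    then obtain w y' where w: "w \<in> W" and y': "\<forall>j<Suc i. f j y' = 0" "norm y' \<le> 2 + s" "norm (y - w - y') < s"
      using W(2) by blast
    define r where "r = y - w - y'"
    have hy: "h = t *\<^sub>R w + (t *\<^sub>R y' + t *\<^sub>R r)"
      unfolding r_def y_def using t by (simp add: algebra_simps)
    have 1: "sdiff F v (2 *\<^sub>R (t *\<^sub>R w)) \<le> (e * t) / 2"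
    proof -
      have "0 < 2 * t \<and> 2 * t < T w" using \<tau>0(2)[OF w] t t_le(1) by simp
      then have "sdiff F v ((2 * t) *\<^sub>R w) \<le> e / 4 * (2 * t)" using T w by blast
      then show ?thesis by simp
    qed
    have 2: "sdiff F v (2 *\<^sub>R (2 *\<^sub>R (t *\<^sub>R y'))) \<le> 2 * (e * t)"
    proof -
      have n: "norm y' \<le> 3" using y'(2) s by simp
      have "2 *\<^sub>R (2 *\<^sub>R (t *\<^sub>R y')) \<in> K m" using y'(1) unfolding K by (simp add: blinfun.scaleR_right)
      then have "sdiff F v (2 *\<^sub>R (2 *\<^sub>R (t *\<^sub>R y')))
          \<le> 4 * d * norm (2 *\<^sub>R (2 *\<^sub>R (t *\<^sub>R y'))) + 2 * a m * (norm (2 *\<^sub>R (2 *\<^sub>R (t *\<^sub>R y'))))\<^sup>2"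
        by (rule sK)
      also have "norm (2 *\<^sub>R (2 *\<^sub>R (t *\<^sub>R y'))) = 4 * t * norm y'" using t by simp
      also have "4 * d * (4 * t * norm y') + 2 * a m * (4 * t * norm y')\<^sup>2
          \<le> 4 * d * (4 * t * 3) + 2 * a m * (4 * t * 3)\<^sup>2"
        using n d t a_pos[of m] by (intro add_mono mult_left_mono power_mono) auto
      also have "\<dots> = e * t + (t * (288 * a m)) * t" unfolding d_def by (simp add: power2_eq_square)
      also have "\<dots> \<le> e * t + e * t" using t t_le(2) by (intro add_left_mono mult_right_mono) auto
      finally show ?thesis by simp
    qed
    have 3: "sdiff F v (2 *\<^sub>R (2 *\<^sub>R (t *\<^sub>R r))) \<le> e * t"
    proof -
      have n: "norm r \<le> s" using y'(3) unfolding r_def by simp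
      have "sdiff F v (2 *\<^sub>R (2 *\<^sub>R (t *\<^sub>R r)))
          \<le> A * norm (2 *\<^sub>R (2 *\<^sub>R (t *\<^sub>R r))) + B * (norm (2 *\<^sub>R (2 *\<^sub>R (t *\<^sub>R r))))\<^sup>2"
        by (rule bound)
      also have "norm (2 *\<^sub>R (2 *\<^sub>R (t *\<^sub>R r))) = 4 * t * norm r" using t by simp
      also have "A * (4 * t * norm r) + B * (4 * t * norm r)\<^sup>2 \<le> A * (4 * t * s) + B * (4 * t * 1)\<^sup>2"
        using n s t AB by (intro add_mono mult_left_mono power_mono) auto
      also have "\<dots> = 4 * t * (A * s) + (t * (32 * B)) * (t / 2)" by (simp add: power2_eq_square)
      also have "\<dots> \<le> 4 * t * (e / 8) + e * (t / 2)"
        using t t_le(3) s by (intro add_mono mult_left_mono mult_right_mono) (auto simp: algebra_simps)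
      finally show ?thesis by simp
    qed
    have "sdiff F v h \<le> (sdiff F v (2 *\<^sub>R (t *\<^sub>R w)) + sdiff F v (2 *\<^sub>R (t *\<^sub>R y') + 2 *\<^sub>R (t *\<^sub>R r))) / 2"
      unfolding hy scaleR_add_right[symmetric, of 2] by (rule sdiff_add[OF F_convex])
    moreover have "sdiff F v (2 *\<^sub>R (t *\<^sub>R y') + 2 *\<^sub>R (t *\<^sub>R r)) \<le>
        (sdiff F v (2 *\<^sub>R (2 *\<^sub>R (t *\<^sub>R y'))) + sdiff F v (2 *\<^sub>R (2 *\<^sub>R (t *\<^sub>R r)))) / 2"
      by (rule sdiff_add[OF F_convex])
    moreover have "s \<le> E" if "s \<le> (p + q) / 2" "q \<le> (r + u) / 2" "p \<le> E / 2" "r \<le> 2 * E" "u \<le> E"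
      for s p q r u E :: real
      using that by simp
    ultimately show ?thesis using 1 2 3 unfolding t_def[symmetric] by blast
  qed
  ultimately show ?thesis by blast
qed

lemma frechet_smooth_N:
  assumes dense: "\<And>g e. e > 0 \<Longrightarrow> \<exists>i c. norm (g - c *\<^sub>R f i) < e"
  shows "frechet_smooth N"
  unfolding frechet_smooth_def uniform_limit_iff
proof (intro ballI allI impI)
  fix v and e :: real
  assume v: "v \<in> unit_sphere N" and e: "e > 0"
  have v1: "N v = 1" using v unfolding unit_sphere_def by simp
  define M where "M = 1 + \<eta>"
  have M: "M > 0" unfolding M_def using \<eta>_pos by simp
  have "e / M > 0" using e M by simp
  then obtain \<tau> where \<tau>: "\<tau> > 0" "\<And>h. norm h < \<tau> \<Longrightarrow> sdiff F v h \<le> e / M * norm h"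
    using F_uniformly_smooth[OF dense, of "e / M" v] by blast
  define d where "d = min (\<tau> / M) (e / (2 * (\<eta> * M\<^sup>2)))"
  have "d > 0" unfolding d_def using \<tau> e M \<eta>_pos by simp
  moreover have "dist ((N (v + h *\<^sub>R y) + N (v - h *\<^sub>R y) - 2) / h) 0 < e"
    if h: "h \<noteq> 0" "\<bar>h\<bar> < d" and y: "y \<in> unit_sphere N" for h y
  proof -
    have ny: "norm y \<le> M" using y norm_le_N[of y] unfolding unit_sphere_def M_def by simp
    have "\<bar>h\<bar> * (2 * (\<eta> * M\<^sup>2)) < e" using h M \<eta>_pos unfolding d_def by (simp add: pos_less_divide_eq)
    moreover have "\<eta> * \<bar>h\<bar> * \<rho> y \<le> \<eta> * \<bar>h\<bar> * M\<^sup>2"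
      using \<eta>_pos weighted_sq_le[of f, OF f_le, of y] power_mono[OF ny, of 2] by (intro mult_left_mono) auto
    ultimately have 1: "\<eta> * \<bar>h\<bar> * \<rho> y < e / 2" by (simp add: algebra_simps)
    have "norm (\<bar>h\<bar> *\<^sub>R y) \<le> \<bar>h\<bar> * M" using ny by (simp add: mult_left_mono)
    moreover have "\<bar>h\<bar> * M < \<tau>" using h M unfolding d_def by (simp add: pos_less_divide_eq)
    ultimately have "norm (\<bar>h\<bar> *\<^sub>R y) < \<tau>" by (rule order_le_less_trans)
    then have "sdiff F v (\<bar>h\<bar> *\<^sub>R y) \<le> e / M * norm (\<bar>h\<bar> *\<^sub>R y)" by (rule \<tau>(2))
    also have "\<dots> \<le> e / M * (\<bar>h\<bar> * M)"
      using \<open>norm (\<bar>h\<bar> *\<^sub>R y) \<le> \<bar>h\<bar> * M\<close> e M by (intro mult_left_mono) auto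
    also have "\<dots> = e * \<bar>h\<bar>" using M by simp
    finally show ?thesis using difference_quotient_N[OF v1 _ h(1), of y e] 1 by (simp add: dist_real_def)
  qed
  ultimately show "\<forall>\<^sub>F h in at 0. \<forall>y\<in>unit_sphere N. dist ((N (v + h *\<^sub>R y) + N (v - h *\<^sub>R y) - 2) / h) 0 < e"
    unfolding eventually_at by (intro exI[of _ d]) (auto simp: dist_real_def)
qed

lemma \<phi>_tot:
  assumes k: "k \<in> adm"
  shows "\<phi> (tot k) = \<phi> (k 0)"
proof -
  let ?A = "insert 0 {i. k i \<noteq> 0}"
  have A: "finite ?A" using k unfolding adm_def by simp
  have "\<phi> (k i) = 0" if "i \<noteq> 0" for i
  proof -
    have ki: "k i \<in> K i" using k unfolding adm_def by blast
    have "f 0 (k i) = 0"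
    proof (cases "even i")
      case True
      with that obtain j where "i div 2 = Suc j" by (metis dvd_div_eq_0_iff not0_implies_Suc)
      then show ?thesis using ki True f_x unfolding K_def by (auto simp: blinfun.scaleR_right)
    next
      case False
      then show ?thesis using ki unfolding K_def by simp
    qed
    then show ?thesis unfolding \<phi>_eq by simp
  qed
  then have "(\<Sum>i\<in>?A - {0}. \<phi> (k i)) = 0" by simp
  moreover have "\<phi> (tot k) = (\<Sum>i\<in>?A. \<phi> (k i))"
    unfolding tot_eq[OF A subset_insertI] by (rule blinfun.sum_right)
  ultimately show ?thesis unfolding sum.remove[OF A insertI1] by simp
qed

text \<open>\<open>G\<close> is constant on the segments \<open>y0 \<plusminus> z\<close> with \<open>z\<close> small in the kernel of \<open>\<phi>\<close>. The
  point \<open>y0 + c *\<^sub>R x 0\<close> is chosen so that its optimal decomposition is \<open>c *\<^sub>R x 0\<close>, with remainder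
  \<open>y0\<close>; hence \<open>F\<close> does not increase along the same segments through it.\<close>

lemma flat_point:
  obtains p r where "r > 0" "p \<noteq> 0" "\<And>z. f 0 z = 0 \<Longrightarrow> norm z \<le> r \<Longrightarrow> F (p + z) \<le> F p"
proof -
  have "\<exists>v. \<bar>\<phi> v\<bar> > norm v"
  proof (rule ccontr)
    assume "\<not> ?thesis"
    then have "norm (\<phi> v) \<le> 1 * norm v" for v by (simp add: not_less)
    then have "norm \<phi> \<le> 1" by (intro norm_blinfun_bound) auto
    then show False using norm_\<phi> \<eta>_pos by simp
  qed
  then obtain v where v: "\<bar>\<phi> v\<bar> > norm v" by blast
  define y0 where "y0 = inverse (\<phi> v) *\<^sub>R v"
  have \<phi>v: "\<phi> v \<noteq> 0" using v by auto
  have y0: "\<phi> y0 = 1" "norm y0 < 1"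
    unfolding y0_def using \<phi>v v by (auto simp: blinfun.scaleR_right field_simps)
  define A where "A = a 0 * (norm (x 0))\<^sup>2"
  have "x 0 \<noteq> 0" using f_x0 by (auto simp: blinfun.zero_right)
  then have A: "A > 0" unfolding A_def using a_pos[of 0] by simp
  define c where "c = \<phi> (x 0) / A"
  have \<phi>x: "\<phi> (x 0) = A * c" unfolding c_def using A by simp
  define p where "p = y0 + c *\<^sub>R x 0"
  have low: "1 + A * c\<^sup>2 \<le> F p"
  proof (rule F_greatest)
    fix k assume k: "k \<in> adm"
    have "k 0 \<in> K 0" using k unfolding adm_def by blast
    then obtain b where b: "k 0 = b *\<^sub>R x 0" unfolding K_def by auto
    have "\<phi> (p - tot k) = 1 + (c - b) * (A * c)"
      unfolding blinfun.diff_right \<phi>_tot[OF k] b p_def blinfun.add_right blinfun.scaleR_right y0 \<phi>x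
      by (simp add: algebra_simps)
    then have "(1 + (c - b) * (A * c))\<^sup>2 \<le> (G (p - tot k))\<^sup>2"
      unfolding G_def by (intro power2_le_iff_abs_le[THEN iffD2]) auto
    moreover have "A * b\<^sup>2 \<le> cost k"
    proof -
      have fin: "finite (insert 0 {i. k i \<noteq> 0})" using k unfolding adm_def by simp
      have "a 0 * (norm (k 0))\<^sup>2 \<le> (\<Sum>i\<in>insert 0 {i. k i \<noteq> 0}. a i * (norm (k i))\<^sup>2)"
        using fin a_pos by (intro member_le_sum) (auto simp: less_imp_le)
      then show ?thesis
        unfolding cost_eq[OF fin subset_insertI] b A_def by (simp add: power_mult_distrib algebra_simps)
    qed
    moreover have "1 + A * c\<^sup>2 \<le> (1 + (c - b) * (A * c))\<^sup>2 + A * b\<^sup>2"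
    proof -
      have "(1 + (c - b) * (A * c))\<^sup>2 + A * b\<^sup>2 = 1 + A * c\<^sup>2 + A * (c - b)\<^sup>2 + ((c - b) * (A * c))\<^sup>2"
        by (simp add: power2_eq_square algebra_simps)
      then show ?thesis using A by simp
    qed
    ultimately show "1 + A * c\<^sup>2 \<le> (G (p - tot k))\<^sup>2 + cost k" by linarith
  qed
  have up: "F (p + z) \<le> 1 + A * c\<^sup>2" if z: "f 0 z = 0" "norm z \<le> 1 - norm y0" for z
  proof -
    have "c *\<^sub>R x 0 \<in> range (\<lambda>c. c *\<^sub>R x 0)" by (rule rangeI)
    then have h: "c *\<^sub>R x 0 \<in> K 0" unfolding K_def by simp
    let ?k = "(\<lambda>i. 0)(0 := 0 + c *\<^sub>R x 0)"
    have "tot ?k = c *\<^sub>R x 0" "cost ?k = A * c\<^sup>2" "?k \<in> adm"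
      using adm_update[OF adm_zero h] unfolding A_def by (simp_all add: power_mult_distrib)
    then have "F (p + z) \<le> (G (y0 + z))\<^sup>2 + A * c\<^sup>2"
      using F_le[of ?k "p + z"] unfolding p_def by (simp add: algebra_simps)
    moreover have "G (y0 + z) \<le> 1"
    proof -
      have "norm (y0 + z) \<le> 1" using norm_triangle_ineq[of y0 z] z(2) by simp
      moreover have "\<phi> (y0 + z) = 1" using y0 z(1) by (simp add: blinfun.add_right \<phi>_eq[of z])
      ultimately show ?thesis unfolding G_def by simp
    qed
    then have "(G (y0 + z))\<^sup>2 \<le> 1" using is_norm_nonneg[OF G_norm] by (simp add: power_le_one)
    ultimately show ?thesis by simp
  qed
  have "p \<noteq> 0"
  proof
    assume "p = 0"
    then have "F p = 0" using F_scale[of 0 0] by simp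
    moreover have "A * c\<^sup>2 \<ge> 0" using A by simp
    ultimately show False using low by simp
  qed
  moreover have "F (p + z) \<le> F p" if "f 0 z = 0" "norm z \<le> 1 - norm y0" for z
    using up[OF that] low by simp
  ultimately show thesis using y0(2) by (intro that[of "1 - norm y0" p]) auto
qed

lemma not_MLUR_N: "\<not> MLUR N"
proof
  assume MLUR: "MLUR N"
  obtain p r where r: "r > 0" and p: "p \<noteq> 0"
    and flat: "\<And>z. f 0 z = 0 \<Longrightarrow> norm z \<le> r \<Longrightarrow> F (p + z) \<le> F p" by (rule flat_point) blast
  have "\<forall>n. \<exists>z. norm z = r \<and> (\<forall>i<Suc n. f i z = 0)"
  proof
    fix n
    obtain z where z: "z \<noteq> 0" "\<forall>i<Suc n. f i z = 0"
      using finite_kernel_nontrivial[OF infinite_dim, of "Suc n" f] by blast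
    then show "\<exists>z. norm z = r \<and> (\<forall>i<Suc n. f i z = 0)" using r
      by (intro exI[of _ "(r / norm z) *\<^sub>R z"]) (simp add: blinfun.scaleR_right)
  qed
  from choice[OF this] obtain z where z': "\<forall>n. norm (z n) = r \<and> (\<forall>i<Suc n. f i (z n) = 0)"
    by (elim exE)
  then have z: "norm (z n) = r" "\<forall>i<Suc n. f i (z n) = 0" for n by auto
  have f0: "f 0 (z n) = 0" for n using z(2) by simp
  define c where "c = N p"
  have c: "c > 0" unfolding c_def using p N_nonneg[of p] N_eq_0[of p] by simp
  define \<alpha> \<beta> where "\<alpha> n = N (p + z n)" and "\<beta> n = N (p - z n)" for n
  have sq: "(\<alpha> n - c)\<^sup>2 + (\<beta> n - c)\<^sup>2 \<le> 2 * \<eta> * \<rho> (z n)" for n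
  proof -
    have "F (p + z n) \<le> F p" "F (p - z n) \<le> F p"
      using flat[of "z n"] flat[of "- z n"] z(1) f0[of n] by (simp_all add: blinfun.minus_right)
    moreover have "\<eta> * (\<rho> (p + z n) + \<rho> (p - z n)) = \<eta> * (2 * \<rho> p + 2 * \<rho> (z n))"
      using weighted_sq_parallelogram[of f, OF f_le, of p "z n"] by simp
    ultimately have "(\<alpha> n)\<^sup>2 + (\<beta> n)\<^sup>2 \<le> 2 * c\<^sup>2 + 2 * \<eta> * \<rho> (z n)"
      unfolding \<alpha>_def \<beta>_def c_def N_power2 Q_def by (simp add: algebra_simps)
    moreover have "2 * c \<le> \<alpha> n + \<beta> n"
    proof -
      have "N ((p + z n) + (p - z n)) = 2 * c" using N_scale[of 2 p] unfolding c_def by (simp add: scaleR_2)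
      then show ?thesis unfolding \<alpha>_def \<beta>_def using N_add[of "p + z n" "p - z n"] by simp
    qed
    then have "2 * c * (2 * c) \<le> 2 * c * (\<alpha> n + \<beta> n)" using c by (intro mult_left_mono) auto
    ultimately show ?thesis by (simp add: power2_eq_square algebra_simps)
  qed
  have lim0: "(\<lambda>n. 2 * \<eta> * \<rho> (z n)) \<longlonglongrightarrow> 0"
  proof (rule tendsto_sandwich[OF _ _ tendsto_const])
    have "(\<lambda>n. (1/2::real) ^ Suc n) \<longlonglongrightarrow> 0" by (rule LIMSEQ_Suc[OF LIMSEQ_realpow_zero]) auto
    then have "(\<lambda>n. 2 * \<eta> * ((1/2) ^ Suc n * r\<^sup>2)) \<longlonglongrightarrow> 2 * \<eta> * (0 * r\<^sup>2)"
      by (intro tendsto_intros)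
    then show "(\<lambda>n. 2 * \<eta> * ((1/2) ^ Suc n * r\<^sup>2)) \<longlonglongrightarrow> 0" by simp
    show "\<forall>\<^sub>F n in sequentially. 2 * \<eta> * \<rho> (z n) \<le> 2 * \<eta> * ((1/2) ^ Suc n * r\<^sup>2)"
      using weighted_sq_kernel_le[of f, OF f_le, of "Suc n" "z n" for n] z \<eta>_pos
      by (intro always_eventually allI mult_left_mono) auto
    show "\<forall>\<^sub>F n in sequentially. 0 \<le> 2 * \<eta> * \<rho> (z n)" using \<eta>_pos \<rho>_nonneg by simp
  qed
  have lim: "\<gamma> \<longlonglongrightarrow> c" if "\<And>n. (\<gamma> n - c)\<^sup>2 \<le> 2 * \<eta> * \<rho> (z n)" for \<gamma> :: "nat \<Rightarrow> real"
  proof -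
    have "(\<lambda>n. (\<gamma> n - c)\<^sup>2) \<longlonglongrightarrow> 0"
      by (rule tendsto_sandwich[OF _ _ tendsto_const lim0]) (use that in auto)
    then have "(\<lambda>n. \<gamma> n - c) \<longlonglongrightarrow> 0" by (rule tendsto_zero_power2_cancel)
    then show ?thesis by (rule LIM_zero_cancel)
  qed
  have "(\<alpha> n - c)\<^sup>2 \<le> 2 * \<eta> * \<rho> (z n)" for n
    by (rule order_trans[OF _ sq]) simp
  then have lim_\<alpha>: "\<alpha> \<longlonglongrightarrow> c" using lim[of \<alpha>] by simp
  have "(\<beta> n - c)\<^sup>2 \<le> 2 * \<eta> * \<rho> (z n)" for n
    by (rule order_trans[OF _ sq]) simp
  then have lim_\<beta>: "\<beta> \<longlonglongrightarrow> c" using lim[of \<beta>] by simp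
  define q u v where "q = inverse c *\<^sub>R p" and "u n = inverse c *\<^sub>R (p + z n)"
    and "v n = inverse c *\<^sub>R (p - z n)" for n
  have Nq: "N q = 1" unfolding q_def N_scale using c c_def by simp
  have "(\<lambda>n. N (u n)) = (\<lambda>n. inverse c * \<alpha> n)" "(\<lambda>n. N (v n)) = (\<lambda>n. inverse c * \<beta> n)"
    unfolding u_def v_def \<alpha>_def \<beta>_def N_scale using c by auto
  moreover have "(\<lambda>n. inverse c * \<alpha> n) \<longlonglongrightarrow> inverse c * c" "(\<lambda>n. inverse c * \<beta> n) \<longlonglongrightarrow> inverse c * c"
    by (intro tendsto_mult tendsto_const lim_\<alpha> lim_\<beta>)+
  ultimately have "(\<lambda>n. N (u n)) \<longlonglongrightarrow> N q" "(\<lambda>n. N (v n)) \<longlonglongrightarrow> N q" unfolding Nq using c by auto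
  moreover have "(u n + v n) /\<^sub>R 2 - q = 0" for n
  proof -
    have "u n + v n = q + q" unfolding u_def v_def q_def by (simp add: scaleR_add_right scaleR_diff_right)
    then show ?thesis unfolding scaleR_2[symmetric] by simp
  qed
  then have "(\<lambda>n. N ((u n + v n) /\<^sub>R 2 - q)) \<longlonglongrightarrow> 0" using N_eq_0[of 0] by simp
  moreover have "MLUR_point N q" using MLUR Nq unfolding MLUR_def unit_sphere_def by simp
  ultimately have "(\<lambda>n. N (u n - v n)) \<longlonglongrightarrow> 0" unfolding MLUR_point_def by simp
  moreover have "2 * r / (c * (1 + \<eta>)) \<le> N (u n - v n)" for n
  proof -
    have "u n - v n = (2 * inverse c) *\<^sub>R z n"
    proof -
      have "u n - v n = inverse c *\<^sub>R z n + inverse c *\<^sub>R z n"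
        unfolding u_def v_def by (simp add: scaleR_add_right scaleR_diff_right)
      then show ?thesis unfolding scaleR_2[symmetric] by simp
    qed
    then have "N (u n - v n) = 2 * inverse c * N (z n)" using N_scale c by simp
    moreover have "r / (1 + \<eta>) \<le> N (z n)" using norm_le_N[of "z n"] z(1)[of n] \<eta>_pos by (simp add: field_simps)
    then have "2 * inverse c * (r / (1 + \<eta>)) \<le> 2 * inverse c * N (z n)" using c by (intro mult_left_mono) auto
    moreover have "2 * r / (c * (1 + \<eta>)) = 2 * inverse c * (r / (1 + \<eta>))" by (simp add: divide_inverse)
    ultimately show ?thesis by simp
  qed
  ultimately have "2 * r / (c * (1 + \<eta>)) \<le> 0"
    using LIMSEQ_le_const[of "\<lambda>n. N (u n - v n)" 0 "2 * r / (c * (1 + \<eta>))"] by blast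
  moreover have "2 * r / (c * (1 + \<eta>)) > 0" using r c \<eta>_pos by simp
  ultimately show False by simp
qed

end

lemma dense_sequence:
  assumes "separable_space (euclidean :: 'b::topological_space topology)"
  obtains d :: "nat \<Rightarrow> 'b::topological_space" where "closure (range d) = UNIV"
proof -
  obtain C :: "'b set" where C: "countable C" "closure C = UNIV"
    using assms unfolding separable_space_def by auto
  then have "C \<noteq> {}" by auto
  then have "range (from_nat_into C) = C" using C(1) by (rule range_from_nat_into)
  then show thesis using C(2) by (intro that[of "from_nat_into C"]) simp
qed

lemma dense_sequence_approx:
  fixes d :: "nat \<Rightarrow> 'b::real_normed_vector"
  assumes "closure (range d) = UNIV" "e > 0"
  obtains i where "norm (v - d i) < e"
proof -
  have "v \<in> closure (range d)" using assms(1) by simp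
  then obtain i where "dist (d i) v < e" using assms(2) unfolding closure_approachable by blast
  then show thesis by (intro that[of i]) (simp add: dist_norm norm_minus_commute)
qed

lemma ex_renorming:
  fixes g :: "nat \<Rightarrow> 'a::real_normed_vector \<Rightarrow>\<^sub>L real" and w :: "nat \<Rightarrow> 'a"
  assumes inf: "\<nexists>B :: 'a set. finite B \<and> span B = UNIV"
    and g_le: "\<And>i. norm (g i) \<le> 1" and g_sep: "\<And>v. (\<And>i. g i v = 0) \<Longrightarrow> v = 0"
    and w: "closure (span (range w)) = UNIV" and \<eta>: "\<eta> > 0"
  shows "\<exists>f x. renorming f x \<eta> \<and> range g \<subseteq> range f"
proof -
  obtain z :: 'a where "z \<noteq> 0" using finite_kernel_nontrivial[OF inf, of 0] by blast
  then obtain j where "g j z \<noteq> 0" using g_sep by blast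
  define f where "f = case_nat (g j) g"
  define x where "x = case_nat z (\<lambda>i. w i - (g j (w i) / g j z) *\<^sub>R z)"
  have f: "f 0 = g j" "f (Suc i) = g i" and x: "x 0 = z" "x (Suc i) = w i - (g j (w i) / g j z) *\<^sub>R z" for i
    unfolding f_def x_def by simp_all
  have "renorming f x \<eta>"
  proof
    show "\<nexists>B :: 'a set. finite B \<and> span B = UNIV" by (rule inf)
    show "norm (f i) \<le> 1" for i using f g_le by (cases i) auto
    show "v = 0" if "\<And>i. f i v = 0" for v
    proof (rule g_sep)
      show "g i v = 0" for i using that[of "Suc i"] f by simp
    qed
    have "w i \<in> span (range x)" for i
    proof -
      have "w i = x (Suc i) + (g j (w i) / g j z) *\<^sub>R x 0" unfolding x by simp
      moreover have "\<dots> \<in> span (range x)" by (intro span_add span_scale span_base rangeI)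
      ultimately show ?thesis by simp
    qed
    then have "span (range w) \<subseteq> span (range x)" by (intro span_minimal) auto
    then have "closure (span (range w)) \<subseteq> closure (span (range x))" by (rule closure_mono)
    then show "closure (span (range x)) = UNIV" using w by auto
    show "f 0 (x 0) \<noteq> 0" using \<open>g j z \<noteq> 0\<close> f x by simp
    show "f 0 (x (Suc i)) = 0" for i
      using \<open>g j z \<noteq> 0\<close> by (simp add: f x blinfun.diff_right blinfun.scaleR_right)
    show "\<eta> > 0" by (rule \<eta>)
  qed
  moreover have "range g \<subseteq> range f" using f by (metis image_subsetI rangeI)
  ultimately show ?thesis by blast
qed

lemma separable_renorming:
  assumes inf: "\<nexists>B :: 'a::real_normed_vector set. finite B \<and> span B = UNIV"
    and sep: "separable_space (euclidean :: 'a topology)" and \<eta>: "\<eta> > 0"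
  shows "\<exists>N :: 'a \<Rightarrow> real. equivalent_norm N \<and> rotund N \<and> gateaux_smooth N \<and> \<not> MLUR N \<and> norm_close \<eta> N"
proof -
  obtain d :: "nat \<Rightarrow> 'a" where d: "closure (range d) = UNIV" using dense_sequence[OF sep] .
  have "\<forall>i. \<exists>g :: 'a \<Rightarrow>\<^sub>L real. norm g \<le> 1 \<and> blinfun_apply g (d i) = norm (d i)"
    using norming_functional by blast
  from choice[OF this] obtain g :: "nat \<Rightarrow> 'a \<Rightarrow>\<^sub>L real"
    where g: "\<forall>i. norm (g i) \<le> 1 \<and> g i (d i) = norm (d i)" by (elim exE)
  have sep: "v = 0" if v: "\<And>i. g i v = 0" for v
  proof (rule ccontr)
    assume "v \<noteq> 0"
    then have "norm v / 2 > 0" by simp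
    then obtain i where i: "norm (v - d i) < norm v / 2" by (rule dense_sequence_approx[OF d])
    have "norm (d i) = g i (d i - v)" using g v by (simp add: blinfun.diff_right)
    also have "\<dots> \<le> norm (g i) * norm (d i - v)" using norm_blinfun[of "g i" "d i - v"] by simp
    also have "\<dots> \<le> 1 * norm (d i - v)" using g by (intro mult_right_mono) auto
    finally have "norm (d i) \<le> norm (v - d i)" by (simp add: norm_minus_commute)
    moreover have "norm v \<le> norm (d i) + norm (v - d i)" using norm_triangle_ineq[of "d i" "v - d i"] by simp
    ultimately show False using i by simp
  qed
  have "range d \<subseteq> span (range d)" using span_superset .
  then have dense_d: "closure (span (range d)) = UNIV" using d closure_mono by blast
  have g_le: "norm (g i) \<le> 1" for i using g by blast
  have "\<exists>f x. renorming f x \<eta> \<and> range g \<subseteq> range f"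
    by (rule ex_renorming) fact+
  then obtain f x where f: "renorming f x \<eta>" "range g \<subseteq> range f" by (elim exE conjE)
  interpret renorming f x \<eta> by (rule f(1))
  show ?thesis
    by (intro exI[of _ N] conjI equivalent_norm_N rotund_N gateaux_smooth_N not_MLUR_N norm_close_N)
qed

lemma almost_norming_vector:
  fixes h :: "'a::real_normed_vector \<Rightarrow>\<^sub>L real"
  shows "\<exists>w. norm w \<le> 1 \<and> norm h \<le> 2 * \<bar>blinfun_apply h w\<bar>"
proof (cases "h = 0")
  case True
  then show ?thesis by (intro exI[of _ 0]) simp
next
  case False
  have "\<exists>v. \<bar>h v\<bar> > norm h / 2 * norm v"
  proof (rule ccontr)
    assume "\<not> ?thesis"
    then have "norm (h v) \<le> norm h / 2 * norm v" for v by (simp add: not_less)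
    then have "norm h \<le> norm h / 2" by (intro norm_blinfun_bound) auto
    then show False using False by simp
  qed
  then obtain v where v: "\<bar>h v\<bar> > norm h / 2 * norm v" by blast
  then have "v \<noteq> 0" by (auto simp: blinfun.zero_right)
  then show ?thesis using v
    by (intro exI[of _ "inverse (norm v) *\<^sub>R v"]) (simp add: blinfun.scaleR_right abs_mult field_simps)
qed

lemma separable_dual_renorming:
  assumes inf: "\<nexists>B :: 'a::real_normed_vector set. finite B \<and> span B = UNIV"
    and sep: "separable_space (euclidean :: ('a \<Rightarrow>\<^sub>L real) topology)" and \<eta>: "\<eta> > 0"
  shows "\<exists>N :: 'a \<Rightarrow> real. equivalent_norm N \<and> weakly_uniformly_rotund N \<and> frechet_smooth N \<and>
    \<not> MLUR N \<and> norm_close \<eta> N"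
proof -
  obtain d :: "nat \<Rightarrow> 'a \<Rightarrow>\<^sub>L real" where d: "closure (range d) = UNIV" using dense_sequence[OF sep] .
  define g where "g i = inverse (1 + norm (d i)) *\<^sub>R d i" for i
  have pos: "1 + norm (d i) > 0" for i by (simp add: add_pos_nonneg)
  have dg: "d i = (1 + norm (d i)) *\<^sub>R g i" for i unfolding g_def using pos[of i] by simp
  have g_le: "norm (g i) \<le> 1" for i unfolding g_def using pos[of i] by (simp add: field_simps)
  have g_sep: "v = 0" if v: "\<And>i. g i v = 0" for v
  proof -
    have dv: "d i v = 0" for i using dg[of i] v[of i] by (metis blinfun.scaleR_left scaleR_zero_right)
    obtain h :: "'a \<Rightarrow>\<^sub>L real" where h: "h v = norm v" using norming_functional[of v] by blast
    have "norm v \<le> e" if "e > 0" for e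
    proof -
      have "e / (norm v + 1) > 0" using that by (simp add: add_nonneg_pos)
      then obtain i where i: "norm (h - d i) < e / (norm v + 1)" by (rule dense_sequence_approx[OF d])
      have "norm v = (h - d i) v" using h dv by (simp add: blinfun.diff_left)
      also have "\<dots> \<le> norm (h - d i) * norm v" using norm_blinfun[of "h - d i" v] by simp
      also have "\<dots> \<le> e / (norm v + 1) * (norm v + 1)" using i that by (intro mult_mono) auto
      also have "\<dots> = e" using norm_ge_zero[of v] by (simp add: add_nonneg_eq_0_iff)
      finally show ?thesis .
    qed
    then have "norm v \<le> 0" by (rule dense_ge)
    then show ?thesis by simp
  qed
  have "\<forall>i. \<exists>w. norm w \<le> 1 \<and> norm (d i) \<le> 2 * \<bar>d i w\<bar>" using almost_norming_vector by blast
  from choice[OF this] obtain w where w: "\<forall>i. norm (w i) \<le> 1 \<and> norm (d i) \<le> 2 * \<bar>d i (w i)\<bar>"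
    by (elim exE)
  have dense_w: "closure (span (range w)) = UNIV"
  proof (rule ccontr)
    assume "\<not> ?thesis"
    then obtain x0 where "x0 \<notin> closure (span (range w))" by blast
    from separating_functional[OF subspace_span this]
    obtain h :: "'a \<Rightarrow>\<^sub>L real" where h: "\<forall>x\<in>span (range w). h x = 0" "h x0 \<noteq> 0"
      by (elim exE conjE)
    have "h \<noteq> 0" using h(2) by auto
    then have "norm h / 3 > 0" by simp
    then obtain i where i: "norm (h - d i) < norm h / 3" by (rule dense_sequence_approx[OF d])
    have "h (w i) = 0" using h(1) by (simp add: span_base)
    then have "\<bar>d i (w i)\<bar> = \<bar>(h - d i) (w i)\<bar>" by (simp add: blinfun.diff_left)
    also have "\<dots> \<le> norm (h - d i) * norm (w i)" using norm_blinfun[of "h - d i" "w i"] by simp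
    also have "\<dots> \<le> norm (h - d i)" using w by (intro mult_left_le) auto
    finally have "\<bar>d i (w i)\<bar> \<le> norm (h - d i)" .
    moreover have "norm (d i) \<le> 2 * \<bar>d i (w i)\<bar>" using w by blast
    moreover have "norm h \<le> norm (d i) + norm (h - d i)" using norm_triangle_ineq[of "d i" "h - d i"] by simp
    ultimately show False using i by simp
  qed
  have "\<exists>f x. renorming f x \<eta> \<and> range g \<subseteq> range f"
    by (rule ex_renorming) fact+
  then obtain f x where f: "renorming f x \<eta>" "range g \<subseteq> range f" by (elim exE conjE)
  have dense: "\<exists>i c. norm (h - c *\<^sub>R f i) < e" if "e > 0" for h e
  proof -
    obtain i where i: "norm (h - d i) < e" using \<open>e > 0\<close> by (rule dense_sequence_approx[OF d])
    obtain j where j: "g i = f j" using f(2) by blast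
    have "norm (h - (1 + norm (d i)) *\<^sub>R f j) < e"
      unfolding j[symmetric] dg[symmetric] by (rule i)
    then show ?thesis by (intro exI)
  qed
  interpret renorming f x \<eta> by (rule f(1))
  show ?thesis
    by (intro exI[of _ N] conjI equivalent_norm_N weakly_uniformly_rotund_N frechet_smooth_N dense
        not_MLUR_N norm_close_N)
qed

theorem theorem1:
  assumes infinite_dim: "\<nexists>B :: 'a::banach set. finite B \<and> span B = UNIV"
  shows
    "(separable_space (euclidean :: 'a topology) \<longrightarrow>
        (\<exists>N :: 'a \<Rightarrow> real. equivalent_norm N \<and> rotund N \<and> gateaux_smooth N \<and> \<not> MLUR N) \<and>
        (\<forall>\<eta>>0. \<exists>N :: 'a \<Rightarrow> real. equivalent_norm N \<and> rotund N \<and> gateaux_smooth N \<and> \<not> MLUR N \<and>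
           norm_close \<eta> N)) \<and>
     (separable_space (euclidean :: ('a \<Rightarrow>\<^sub>L real) topology) \<longrightarrow>
        (\<exists>N :: 'a \<Rightarrow> real. equivalent_norm N \<and> weakly_uniformly_rotund N \<and> frechet_smooth N \<and>
           \<not> MLUR N) \<and>
        (\<forall>\<eta>>0. \<exists>N :: 'a \<Rightarrow> real. equivalent_norm N \<and> weakly_uniformly_rotund N \<and> frechet_smooth N \<and>
           \<not> MLUR N \<and> norm_close \<eta> N))"
proof (intro conjI impI allI)
  assume sep: "separable_space (euclidean :: 'a topology)"
  show "\<exists>N :: 'a \<Rightarrow> real. equivalent_norm N \<and> rotund N \<and> gateaux_smooth N \<and> \<not> MLUR N \<and> norm_close \<eta> N"
    if "\<eta> > 0" for \<eta>
    by (rule separable_renorming[OF infinite_dim sep that])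
  from this[OF zero_less_one]
  show "\<exists>N :: 'a \<Rightarrow> real. equivalent_norm N \<and> rotund N \<and> gateaux_smooth N \<and> \<not> MLUR N" by blast
next
  assume sep: "separable_space (euclidean :: ('a \<Rightarrow>\<^sub>L real) topology)"
  show "\<exists>N :: 'a \<Rightarrow> real. equivalent_norm N \<and> weakly_uniformly_rotund N \<and> frechet_smooth N \<and>
      \<not> MLUR N \<and> norm_close \<eta> N" if "\<eta> > 0" for \<eta>
    by (rule separable_dual_renorming[OF infinite_dim sep that])
  from this[OF zero_less_one]
  show "\<exists>N :: 'a \<Rightarrow> real. equivalent_norm N \<and> weakly_uniformly_rotund N \<and> frechet_smooth N \<and> \<not> MLUR N"
    by blast
qed

end
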